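(* Let $\gamma\in(0,1)$, $\beta>2$, $\nu>0$, and let a sequence of sparse vectors $\{\mathbf{x}^{(M)}\in\mathbb{C}^M\}_M$ with $\|\mathbf{x}^{(M)}\|_0=L=\lfloor M/\beta\rfloor$ be given such that $P=\|\mathbf{x}^{(M)}\|_2^2$ is constant (independent of $M$). Then there is a constant $C_5>1$, depending only on $\beta$, $\gamma$, $P$ and $\nu$, such that asymptotic reliable recovery is possible for $\{\mathbf{x}^{(M)}\}$ with respect to Error Metric 3 if $N\succ C_5 L$.
   Context: Model: $\beta>2$ and $\nu>0$ are fixed. For each $M$ (large enough that $L\ge 1$), $\mathbf{x}=\mathbf{x}^{(M)}\in\mathbb{C}^M$ has support $\mathcal{I}=\{i: x_i\ne 0\}$ with $\|\mathbf{x}\|_0=|\mathcal{I}|=L=\lfloor M/\beta\rfloor$ and $P=\|\mathbf{x}\|_2^2$. The number of measurements $N=N(M)\ge 1$ is a function of $M$. One observes $\mathbf{y}=\mathbf{A}\mathbf{x}+\mathbf{n}\in\mathbb{C}^N$, where $\mathbf{A}$ is an $N\times M$ Gaussian measurement matrix with i.i.d. circularly symmetric complex Gaussian entries of mean $0$ and variance $1$ ($\mathcal{N}_C(0,1)$), and $\mathbf{n}\sim\mathcal{N}_C(0,\nu^2 I_N)$ is independent of $\mathbf{A}$. Decoder: a (measurable) decoder $\mathcal{D}$ maps $\mathbf{y}$ (with $\mathbf{A}$ known) to a set $\mathcal{D}(\mathbf{y})=\mathcal{D}(\mathbf{y},\mathbf{A})\subset\{1,\dots,M\}$ of exactly $L$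 indices. It may depend on $M,N,L,\nu,\gamma$ and on the values of the nonzero entries of $\mathbf{x}$, but has no a priori information about the support: for every permutation $\pi$ of $\{1,\dots,M\}$ and every $\mathbf{A}$ with pairwise distinct columns, if $\mathbf{A}^\pi$ is the matrix whose $\pi(j)$-th column is the $j$-th column of $\mathbf{A}$, then $\mathcal{D}(\mathbf{y},\mathbf{A}^\pi)=\pi(\mathcal{D}(\mathbf{y},\mathbf{A}))$. Error Metric 3 (parameter $\gamma\in(0,1)$): recovery is successful iff $\sum_{k\in\mathcal{D}(\mathbf{y})\cap\mathcal{I}}|x_k|^2>(1-\gamma)P$; otherwise an error occurs. Let $p_{\rm err}(\mathbf{A}|\mathbf{x}^{(M)})$ be the probability of error over $\mathbf{n}$ for fixed $\mathbf{A}$, and $p_{\rm err}(\mathcal{D}|\mathbf{x}^{(M)})=\mathbb{E}_{\mathbf{A}}\,p_{\rm err}(\mathbf{A}|\mathbf{x}^{(M)})$. Asymptotic reliable recovery is possible if there is a sequence of decoders with $p_{\rm err}(\mathcal{D}|\mathbf{x}^{(M)})\to 0$ as $M\to\infty$. Notation: for functions $f,g$ of $M$, $f\succ g$ means that either $f=g=0$, or $f,g$ are non-decreasing non-negative functions and there is $M_0$ with $f(M)/g(M)>1$ for all $M>M_0$. *)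

theory Defs
  imports "HOL-Probability.Probability" "HOL-Combinatorics.Permutations"
begin

text \<open>
  Since \<open>M\<close> and \<open>N\<close> vary inside the statement, vectors in \<open>\<complex>\<^sup>m\<close> are functions on the index
  set \<open>{1..m}\<close> and \<open>n \<times> m\<close> matrices are functions on \<open>{1..n} \<times> {1..m}\<close>.
  The random ones are extensional, i.e. points of the space of a product measure.
\<close>

text \<open>Real and imaginary part are independent with variance \<open>v / 2\<close> each, so \<open>v = E \<bar>Z\<bar>\<^sup>2\<close>.\<close>

definition complex_gaussian :: "real \<Rightarrow> complex measure" where
  "complex_gaussian v =
     (let G = density lborel (\<lambda>t. ennreal (normal_density 0 (sqrt (v / 2)) t))
      in distr (G \<Otimes>\<^sub>M G) borel (\<lambda>(a, b). Complex a b))"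

definition gaussian_matrix :: "nat \<Rightarrow> nat \<Rightarrow> (nat \<times> nat \<Rightarrow> complex) measure" where
  "gaussian_matrix N M = (\<Pi>\<^sub>M p\<in>{1..N} \<times> {1..M}. complex_gaussian 1)"

definition gaussian_noise :: "nat \<Rightarrow> real \<Rightarrow> (nat \<Rightarrow> complex) measure" where
  "gaussian_noise N \<nu> = (\<Pi>\<^sub>M i\<in>{1..N}. complex_gaussian (\<nu>\<^sup>2))"

definition vec_space :: "nat \<Rightarrow> (nat \<Rightarrow> complex) measure" where
  "vec_space N = (\<Pi>\<^sub>M i\<in>{1..N}. borel)"

definition mat_space :: "nat \<Rightarrow> nat \<Rightarrow> (nat \<times> nat \<Rightarrow> complex) measure" where
  "mat_space N M = (\<Pi>\<^sub>M p\<in>{1..N} \<times> {1..M}. borel)"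

definition support :: "nat \<Rightarrow> (nat \<Rightarrow> complex) \<Rightarrow> nat set" where
  "support M x = {i \<in> {1..M}. x i \<noteq> 0}"

definition energy :: "nat \<Rightarrow> (nat \<Rightarrow> complex) \<Rightarrow> real" where
  "energy M x = (\<Sum>i\<in>{1..M}. (cmod (x i))\<^sup>2)"

definition sparsity :: "real \<Rightarrow> nat \<Rightarrow> nat" where
  "sparsity \<beta> M = nat \<lfloor>real M / \<beta>\<rfloor>"

definition observation ::
  "nat \<Rightarrow> nat \<Rightarrow> (nat \<Rightarrow> complex) \<Rightarrow> (nat \<times> nat \<Rightarrow> complex) \<Rightarrow> (nat \<Rightarrow> complex) \<Rightarrow> nat \<Rightarrow> complex"
where
  "observation N M x A n = (\<lambda>i\<in>{1..N}. (\<Sum>j\<in>{1..M}. A (i, j) * x j) + n i)"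

definition permute_columns ::
  "nat \<Rightarrow> nat \<Rightarrow> (nat \<Rightarrow> nat) \<Rightarrow> (nat \<times> nat \<Rightarrow> complex) \<Rightarrow> nat \<times> nat \<Rightarrow> complex" where
  "permute_columns N M \<pi> A = (\<lambda>(i, j)\<in>{1..N} \<times> {1..M}. A (i, inv \<pi> j))"

definition distinct_columns :: "nat \<Rightarrow> nat \<Rightarrow> (nat \<times> nat \<Rightarrow> complex) \<Rightarrow> bool" where
  "distinct_columns N M A \<longleftrightarrow>
     (\<forall>j\<in>{1..M}. \<forall>k\<in>{1..M}. j \<noteq> k \<longrightarrow> (\<exists>i\<in>{1..N}. A (i, j) \<noteq> A (i, k)))"

text \<open>
  The last conjunct says that the decoder has no a priori information about the support:
  relabelling the columns of the matrix relabels the decoded set accordingly.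
\<close>

definition is_decoder ::
  "nat \<Rightarrow> nat \<Rightarrow> nat \<Rightarrow> ((nat \<Rightarrow> complex) \<Rightarrow> (nat \<times> nat \<Rightarrow> complex) \<Rightarrow> nat set) \<Rightarrow> bool" where
  "is_decoder M N L D \<longleftrightarrow>
     (\<lambda>(y, A). D y A) \<in> measurable (vec_space N \<Otimes>\<^sub>M mat_space N M) (count_space UNIV) \<and>
     (\<forall>y\<in>space (vec_space N). \<forall>A\<in>space (mat_space N M). D y A \<subseteq> {1..M} \<and> card (D y A) = L) \<and>
     (\<forall>y\<in>space (vec_space N). \<forall>A\<in>space (mat_space N M). \<forall>\<pi>.
        \<pi> permutes {1..M} \<longrightarrow> distinct_columns N M A \<longrightarrow>
        D y (permute_columns N M \<pi> A) = \<pi> ` D y A)"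

definition success3 :: "real \<Rightarrow> nat \<Rightarrow> (nat \<Rightarrow> complex) \<Rightarrow> nat set \<Rightarrow> bool" where
  "success3 \<gamma> M x S \<longleftrightarrow> (\<Sum>k\<in>S \<inter> support M x. (cmod (x k))\<^sup>2) > (1 - \<gamma>) * energy M x"

definition p_err_given ::
  "real \<Rightarrow> real \<Rightarrow> nat \<Rightarrow> nat \<Rightarrow> ((nat \<Rightarrow> complex) \<Rightarrow> (nat \<times> nat \<Rightarrow> complex) \<Rightarrow> nat set) \<Rightarrow>
    (nat \<Rightarrow> complex) \<Rightarrow> (nat \<times> nat \<Rightarrow> complex) \<Rightarrow> real" where
  "p_err_given \<gamma> \<nu> M N D x A =
     measure (gaussian_noise N \<nu>)
       {n \<in> space (gaussian_noise N \<nu>). \<not> success3 \<gamma> M x (D (observation N M x A n) A)}"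

definition p_err ::
  "real \<Rightarrow> real \<Rightarrow> nat \<Rightarrow> nat \<Rightarrow> ((nat \<Rightarrow> complex) \<Rightarrow> (nat \<times> nat \<Rightarrow> complex) \<Rightarrow> nat set) \<Rightarrow>
    (nat \<Rightarrow> complex) \<Rightarrow> real" where
  "p_err \<gamma> \<nu> M N D x = (\<integral>A. p_err_given \<gamma> \<nu> M N D x A \<partial>gaussian_matrix N M)"

text \<open>
  The model only makes sense for \<open>M\<close> with \<open>L \<ge> 1\<close>; for smaller \<open>M\<close> the vector would be zero,
  in contradiction to its energy being a positive constant.
\<close>

definition admissible :: "real \<Rightarrow> nat set" where
  "admissible \<beta> = {M. sparsity \<beta> M \<ge> 1}"

definition asymptotic_reliable_recovery3 ::
  "real \<Rightarrow> real \<Rightarrow> real \<Rightarrow> (nat \<Rightarrow> nat) \<Rightarrow> (nat \<Rightarrow> nat \<Rightarrow> complex) \<Rightarrow> bool" where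
  "asymptotic_reliable_recovery3 \<gamma> \<beta> \<nu> N x \<longleftrightarrow>
     (\<exists>D. (\<forall>M\<in>admissible \<beta>. is_decoder M (N M) (sparsity \<beta> M) (D M)) \<and>
          (\<lambda>M. p_err \<gamma> \<nu> M (N M) (D M) (x M)) \<longlonglongrightarrow> 0)"

text \<open>The relation \<open>f \<succ> g\<close> for functions on a set \<open>S\<close> of indices.\<close>

definition succ_on :: "nat set \<Rightarrow> (nat \<Rightarrow> real) \<Rightarrow> (nat \<Rightarrow> real) \<Rightarrow> bool" where
  "succ_on S f g \<longleftrightarrow>
     (\<forall>M\<in>S. f M = 0 \<and> g M = 0) \<or>
     (mono_on S f \<and> mono_on S g \<and> (\<forall>M\<in>S. f M \<ge> 0 \<and> g M \<ge> 0) \<and>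
      (\<exists>M0. \<forall>M\<in>S. M > M0 \<longrightarrow> f M / g M > 1))"

end

theory Submission
  imports Defs "HOL-Library.Fun_Lexorder"
begin

text \<open>
  Since \<open>L\<close> is proportional to \<open>M\<close>, a large constant \<open>C\<^sub>5\<close> puts us in the regime \<open>N \<ge> c M\<close> with \<open>c\<close>
  as large as desired, where a matched filter suffices. Put
  \<open>h\<^sub>j = (2 / N) \<Sum>\<^sub>i cnj (A\<^sub>i\<^sub>j) Re y\<^sub>i\<close>, an unbiased estimator of \<open>x\<^sub>j\<close>, and decode to the \<open>L\<close> indices
  with the largest \<open>\<bar>h\<^sub>j\<bar>\<close>. The energy of \<open>x\<close> on the missed indices is at most \<open>2 \<parallel>h - x\<parallel>\<^sup>2\<close>, because
  missed and wrongly chosen indices can be matched up, so an error forces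
  \<open>\<parallel>h - x\<parallel>\<^sup>2 \<ge> \<gamma> P / 2\<close>.

  Now \<open>h - x\<close> is the average of \<open>N\<close> independent centred vectors, one for each row of the
  observation, so \<open>E \<parallel>h - x\<parallel>\<^sup>2 = O (M / N)\<close> is below \<open>\<gamma> P / 4\<close> for a suitable \<open>C\<^sub>5\<close>, and
  the variance of \<open>\<parallel>h - x\<parallel>\<^sup>2\<close> is \<open>O (1 / N)\<close>. Chebyshev's inequality finishes the proof.
\<close>

text \<open>When \<open>N\<close> is only proportional to \<open>M\<close>, the mean of the squared
  error need not tend to 0, and Markov's inequality would leave a constant probability of error; the
  squared norm has to concentrate. Its coordinates are dependent, because all \<open>h_j\<close>
  share one observation, so independence is used between rows only.

  The variance is small because the covariance of a row is bounded in every direction by a constant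
  \<open>\<kappa>\<close> that does not grow with \<open>M\<close>. Adding a row to a partial sum
  \<open>s\<close> costs a multiple of \<open>\<kappa>\<close> times the squared norm of
  \<open>s\<close>, and the variance of the unnormalised squared norm is of order M N^2 + M^2 N,
  against a squared threshold of order N^4. Cauchy-Schwarz on the cross term would put a trace of
  order M in place of \<open>\<kappa>\<close>, and M^2 N^2 does not become negligible.

  Taking real parts makes the observation of a row a real linear combination of independent standard
  normals, whose even moments are explicit. The price is the factor 2 in \<open>h_j\<close>, since
  \<open>cnj A * Re y\<close> has mean \<open>x / 2\<close>.\<close>

section \<open>Squared norm of a sum of independent vectors\<close>

lemma integrable_nonneg_bound:
  fixes f g :: "'a \<Rightarrow> real"
  assumes "integrable M f" "g \<in> borel_measurable M" "\<And>x. 0 \<le> g x" "\<And>x. g x \<le> f x"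
  shows "integrable M g"
proof (rule Bochner_Integration.integrable_bound[OF assms(1,2)], rule AE_I2)
  fix x show "norm (g x) \<le> norm (f x)" using assms(3)[of x] assms(4)[of x] by simp
qed

text \<open>
  The step of an induction over the rows: \<open>s\<close> is the sum of the earlier rows and \<open>a\<close> its squared norm
  minus the mean. The increment is centred, so its second moment is simply added to \<open>a\<^sup>2\<close>.
\<close>

lemma (in prob_space) increment_moments:
  fixes Z :: "'j \<Rightarrow> 'a \<Rightarrow> real" and s :: "'j \<Rightarrow> real" and a :: real and J :: "'j set"
  defines "m \<equiv> expectation (\<lambda>x. \<Sum>j\<in>J. (Z j x)\<^sup>2)"
  assumes J: "finite J"
    and Z [measurable]: "\<And>j. j \<in> J \<Longrightarrow> Z j \<in> borel_measurable M"
    and int: "integrable M (\<lambda>x. (\<Sum>j\<in>J. (Z j x)\<^sup>2)\<^sup>2)"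
    and mean: "\<And>j. j \<in> J \<Longrightarrow> expectation (Z j) = 0"
    and quad: "\<And>u. expectation (\<lambda>x. (\<Sum>j\<in>J. u j * Z j x)\<^sup>2) \<le> \<kappa> * (\<Sum>j\<in>J. (u j)\<^sup>2)"
    and four: "expectation (\<lambda>x. (\<Sum>j\<in>J. (Z j x)\<^sup>2)\<^sup>2) \<le> \<mu>"
  shows "(\<integral>\<^sup>+x. ennreal (\<Sum>j\<in>J. (s j + Z j x)\<^sup>2) \<partial>M) = ennreal ((\<Sum>j\<in>J. (s j)\<^sup>2) + m)" (is ?A)
    and "(\<integral>\<^sup>+x. ennreal ((a + (\<Sum>j\<in>J. (s j + Z j x)\<^sup>2) - (\<Sum>j\<in>J. (s j)\<^sup>2) - m)\<^sup>2) \<partial>M)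
          \<le> ennreal (a\<^sup>2 + 8 * \<kappa> * (\<Sum>j\<in>J. (s j)\<^sup>2) + 2 * \<mu>)" (is ?B)
proof -
  let ?Q = "\<lambda>x. \<Sum>j\<in>J. (Z j x)\<^sup>2"
  have intQ: "integrable M ?Q"
    using int by (rule square_integrable_imp_integrable[rotated]) measurable
  have Zle: "(Z j x)\<^sup>2 \<le> ?Q x" if "j \<in> J" for j x
    using J that by (intro member_le_sum) auto
  have intZ2: "integrable M (\<lambda>x. (Z j x)\<^sup>2)" if "j \<in> J" for j
    by (rule Bochner_Integration.integrable_bound[OF intQ]) (use that Zle[OF that] in \<open>auto simp: sum_nonneg\<close>)
  have intZ: "integrable M (Z j)" if "j \<in> J" for j
    using intZ2[OF that] by (rule square_integrable_imp_integrable[rotated]) (use that in measurable)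
  let ?X = "\<lambda>x. \<Sum>j\<in>J. s j * Z j x"
  have intX: "integrable M ?X" by (intro Bochner_Integration.integrable_sum integrable_mult_right intZ)
  have EX: "expectation ?X = 0"
    using mean by (subst Bochner_Integration.integral_sum) (auto intro!: integrable_mult_right intZ)
  have X2le: "(?X x)\<^sup>2 \<le> (\<Sum>j\<in>J. (s j)\<^sup>2) * ?Q x" for x
    by (rule Cauchy_Schwarz_ineq_sum)
  have intX2: "integrable M (\<lambda>x. (?X x)\<^sup>2)"
    by (rule Bochner_Integration.integrable_bound[OF integrable_mult_right[OF intQ, of "\<Sum>j\<in>J. (s j)\<^sup>2"]])
       (use X2le in \<open>auto simp: sum_nonneg\<close>)
  have expand: "(\<Sum>j\<in>J. (s j + Z j x)\<^sup>2) = (\<Sum>j\<in>J. (s j)\<^sup>2) + 2 * ?X x + ?Q x" for x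
    by (simp add: power2_sum sum.distrib sum_distrib_left algebra_simps)
  have intE: "integrable M (\<lambda>x. \<Sum>j\<in>J. (s j + Z j x)\<^sup>2)"
    unfolding expand using intQ intX by simp
  have "(\<integral>\<^sup>+x. ennreal (\<Sum>j\<in>J. (s j + Z j x)\<^sup>2) \<partial>M) = ennreal (expectation (\<lambda>x. \<Sum>j\<in>J. (s j + Z j x)\<^sup>2))"
    by (rule nn_integral_eq_integral[OF intE]) (simp add: sum_nonneg)
  also have "expectation (\<lambda>x. \<Sum>j\<in>J. (s j + Z j x)\<^sup>2) = (\<Sum>j\<in>J. (s j)\<^sup>2) + m"
    unfolding expand using intQ intX EX by (simp add: m_def prob_space)
  finally show ?A .

  let ?Y = "\<lambda>x. ?Q x - m"
  \<comment> \<open>The change of the centred squared norm: a cross term, controlled by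
    \<open>quad\<close>, and a centred square, controlled by \<open>four\<close>. Splitting its
    square as \<open>8 * X\<^sup>2 + 2 * Y\<^sup>2\<close> avoids the mixed moment of the two and
    produces the constants 8 and 2 of the statement.\<close>
  let ?U = "\<lambda>x. 2 * ?X x + ?Y x"
  have varQ: "expectation (\<lambda>x. (?Y x)\<^sup>2) \<le> \<mu>"
  proof -
    have "expectation (\<lambda>x. (?Y x)\<^sup>2) = expectation (\<lambda>x. (?Q x)\<^sup>2) - m\<^sup>2"
      unfolding m_def using variance_eq[OF intQ int] by simp
    then show ?thesis using four by (smt (verit) zero_le_power2)
  qed
  have intY2: "integrable M (\<lambda>x. (?Y x)\<^sup>2)"
    unfolding power2_diff by (intro Bochner_Integration.integrable_add Bochner_Integration.integrable_diff int integrable_mult_left integrable_mult_right intQ) auto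
  have intU: "integrable M ?U" using intX intQ by auto
  have U2le: "(?U x)\<^sup>2 \<le> 8 * (?X x)\<^sup>2 + 2 * (?Y x)\<^sup>2" for x
    using zero_le_power2[of "2 * ?X x - ?Y x"] by (simp add: power2_eq_square algebra_simps)
  have intB: "integrable M (\<lambda>x. 8 * (?X x)\<^sup>2 + 2 * (?Y x)\<^sup>2)" using intX2 intY2 by auto
  have intU2: "integrable M (\<lambda>x. (?U x)\<^sup>2)"
    by (rule Bochner_Integration.integrable_bound[OF intB]) (use U2le in auto)
  have EU: "expectation ?U = 0" using intX intQ EX by (simp add: m_def prob_space)
  have EU2: "expectation (\<lambda>x. (?U x)\<^sup>2) \<le> 8 * \<kappa> * (\<Sum>j\<in>J. (s j)\<^sup>2) + 2 * \<mu>"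
  proof -
    have "expectation (\<lambda>x. (?U x)\<^sup>2) \<le> expectation (\<lambda>x. 8 * (?X x)\<^sup>2 + 2 * (?Y x)\<^sup>2)"
      by (rule integral_mono[OF intU2 intB U2le])
    also have "\<dots> = 8 * expectation (\<lambda>x. (?X x)\<^sup>2) + 2 * expectation (\<lambda>x. (?Y x)\<^sup>2)"
      using intX2 intY2 by simp
    finally show ?thesis using quad[of s] varQ by simp
  qed
  have shift: "a + (\<Sum>j\<in>J. (s j + Z j x)\<^sup>2) - (\<Sum>j\<in>J. (s j)\<^sup>2) - m = a + ?U x" for x
    by (simp add: expand)
  have sq: "(a + ?U x)\<^sup>2 = a\<^sup>2 + 2 * a * ?U x + (?U x)\<^sup>2" for x 
    by (simp add: power2_sum)
  have intS: "integrable M (\<lambda>x. (a + ?U x)\<^sup>2)"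
    unfolding sq by (intro Bochner_Integration.integrable_add integrable_mult_right intU intU2) auto
  have "(\<integral>\<^sup>+x. ennreal ((a + ?U x)\<^sup>2) \<partial>M) = ennreal (expectation (\<lambda>x. (a + ?U x)\<^sup>2))"
    by (rule nn_integral_eq_integral[OF intS]) simp
  also have "expectation (\<lambda>x. (a + ?U x)\<^sup>2) = a\<^sup>2 + 2 * a * expectation ?U + expectation (\<lambda>x. (?U x)\<^sup>2)"
    unfolding sq using intU intU2 by (simp add: prob_space)
  also have "\<dots> \<le> a\<^sup>2 + 8 * \<kappa> * (\<Sum>j\<in>J. (s j)\<^sup>2) + 2 * \<mu>" using EU EU2 by simp
  finally show ?B unfolding shift by (simp add: ennreal_leI)
qed

text \<open>The rows are integrated out one at a time. After \<open>n\<close> rows the expected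
  squared norm is at most \<open>n * \<tau>\<close>, so the next row adds at most
  \<open>8 * \<kappa> * \<tau> * n + 2 * \<mu>\<close>, and summation over \<open>n\<close> gives
  the bound. Nonnegative integrals let Tonelli apply without integrability on the product
  space.\<close>

lemma second_moment_squared_norm_PiM:
  fixes R :: "nat \<Rightarrow> 'a measure" and Z :: "nat \<Rightarrow> 'j \<Rightarrow> 'a \<Rightarrow> real" and J :: "'j set"
  defines "m \<equiv> \<lambda>i. \<integral>x. (\<Sum>j\<in>J. (Z i j x)\<^sup>2) \<partial>R i"
  assumes R: "\<And>i. prob_space (R i)" and J: "finite J"
    and Z: "\<And>i j. j \<in> J \<Longrightarrow> Z i j \<in> borel_measurable (R i)"
    and int: "\<And>i. integrable (R i) (\<lambda>x. (\<Sum>j\<in>J. (Z i j x)\<^sup>2)\<^sup>2)"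
    and mean: "\<And>i j. j \<in> J \<Longrightarrow> (\<integral>x. Z i j x \<partial>R i) = 0"
    and quad: "\<And>i u. (\<integral>x. (\<Sum>j\<in>J. u j * Z i j x)\<^sup>2 \<partial>R i) \<le> \<kappa> * (\<Sum>j\<in>J. (u j)\<^sup>2)"
    and four: "\<And>i. (\<integral>x. (\<Sum>j\<in>J. (Z i j x)\<^sup>2)\<^sup>2 \<partial>R i) \<le> \<mu>"
    and m: "\<And>i. m i \<le> \<tau>" and \<kappa>: "\<kappa> \<ge> 0"
    and I: "finite I"
  shows "(\<integral>\<^sup>+\<omega>. ennreal (((\<Sum>j\<in>J. (\<Sum>i\<in>I. Z i j (\<omega> i))\<^sup>2) - (\<Sum>i\<in>I. m i))\<^sup>2) \<partial>PiM I R)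
           \<le> ennreal (8 * \<kappa> * \<tau> * (real (card I))\<^sup>2 + 2 * \<mu> * real (card I))"
proof -
  interpret product_prob_space R UNIV
    by (intro product_prob_spaceI R)
  \<comment> \<open>\<open>R\<close> is indexed by all natural numbers, so row 0 shows that
    \<open>\<tau>\<close> and \<open>\<mu>\<close> are nonnegative even for empty \<open>I\<close>;
    the \<open>ennreal\<close> arithmetic below relies on this.\<close>
  have "0 \<le> m 0" unfolding m_def by (intro integral_nonneg_AE AE_I2 sum_nonneg) simp
  then have \<tau>: "\<tau> \<ge> 0" using m[of 0] by simp
  have "0 \<le> (\<integral>x. (\<Sum>j\<in>J. (Z 0 j x)\<^sup>2)\<^sup>2 \<partial>R 0)" by (intro integral_nonneg_AE AE_I2) simp
  then have \<mu>: "\<mu> \<ge> 0" using four[of 0] by (rule order_trans)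
  have meas: "(\<lambda>\<omega>. Z i j (\<omega> i)) \<in> borel_measurable (PiM I' R)" if "i \<in> I'" "j \<in> J" for i j I'
    using Z[OF that(2)] that(1) by measurable
  have measS: "(\<lambda>\<omega>. (\<Sum>j\<in>J. (\<Sum>i\<in>I'. Z i j (\<omega> i))\<^sup>2)) \<in> borel_measurable (PiM I' R)" for I'
    by (intro borel_measurable_sum borel_measurable_power meas)
  have inc1: "(\<integral>\<^sup>+x. ennreal (\<Sum>j\<in>J. (s j + Z k j x)\<^sup>2) \<partial>R k) = ennreal ((\<Sum>j\<in>J. (s j)\<^sup>2) + m k)" for k s
    unfolding m_def by (rule prob_space.increment_moments(1)[OF R]) (use J Z int mean quad four in auto)
  have inc2: "(\<integral>\<^sup>+x. ennreal ((a + (\<Sum>j\<in>J. (s j + Z k j x)\<^sup>2) - (\<Sum>j\<in>J. (s j)\<^sup>2) - m k)\<^sup>2) \<partial>R k)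
          \<le> ennreal (a\<^sup>2 + 8 * \<kappa> * (\<Sum>j\<in>J. (s j)\<^sup>2) + 2 * \<mu>)" for k s a
    unfolding m_def by (rule prob_space.increment_moments(2)[OF R]) (use J Z int mean quad four in auto)
  let ?S = "\<lambda>I' \<omega>. \<Sum>j\<in>J. (\<Sum>i\<in>I'. Z i j (\<omega> i))\<^sup>2"
  have upd: "(\<Sum>i\<in>insert k I'. Z i j ((fun_upd \<omega> k r) i)) = (\<Sum>i\<in>I'. Z i j (\<omega> i)) + Z k j r"
    if "finite I'" "k \<notin> I'" for k I' \<omega> r j
  proof -
    have "(\<Sum>i\<in>I'. Z i j ((fun_upd \<omega> k r) i)) = (\<Sum>i\<in>I'. Z i j (\<omega> i))"
      using that by (intro sum.cong) auto
    then show ?thesis using that by simp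
  qed
  have A: "(\<integral>\<^sup>+\<omega>. ennreal (?S I' \<omega>) \<partial>PiM I' R) \<le> ennreal (real (card I') * \<tau>)" if "finite I'" for I'
    using that
  proof induction
    case (insert k I')
    have "(\<integral>\<^sup>+\<omega>. ennreal (?S (insert k I') \<omega>) \<partial>PiM (insert k I') R)
        = (\<integral>\<^sup>+\<omega>. \<integral>\<^sup>+r. ennreal (?S (insert k I') (fun_upd \<omega> k r)) \<partial>R k \<partial>PiM I' R)"
      by (intro product_nn_integral_insert insert(1,2)) (measurable, erule meas)
    also have "\<dots> = (\<integral>\<^sup>+\<omega>. ennreal (?S I' \<omega> + m k) \<partial>PiM I' R)"
      unfolding upd[OF insert(1,2)] inc1 ..
    also have "\<dots> \<le> (\<integral>\<^sup>+\<omega>. ennreal (?S I' \<omega>) + ennreal \<tau> \<partial>PiM I' R)"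
      using m[of k] \<tau> 
      by (intro nn_integral_mono, subst ennreal_plus[symmetric]) (auto intro!: ennreal_leI sum_nonneg)
    also have "\<dots> = (\<integral>\<^sup>+\<omega>. ennreal (?S I' \<omega>) \<partial>PiM I' R) + ennreal \<tau>"
      using measS prob_space.emeasure_space_1[OF prob_space_PiM[of I' R]] R by (subst nn_integral_add) auto
    also have "\<dots> \<le> ennreal (real (card I') * \<tau>) + ennreal \<tau>"
      by (intro add_right_mono insert)
    also have "\<dots> = ennreal (real (card (insert k I')) * \<tau>)"
      using insert \<tau> by (simp flip: ennreal_plus add: algebra_simps)
    finally show ?case .
  qed (auto simp: nn_integral_empty)
  let ?T = "\<lambda>I' \<omega>. ?S I' \<omega> - (\<Sum>i\<in>I'. m i)"
  show "(\<integral>\<^sup>+\<omega>. ennreal ((?T I \<omega>)\<^sup>2) \<partial>PiM I R)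
           \<le> ennreal (8 * \<kappa> * \<tau> * (real (card I))\<^sup>2 + 2 * \<mu> * real (card I))"
    using I
  proof induction
    case (insert k I')
    let ?n = "real (card I')"
    have "(\<integral>\<^sup>+\<omega>. ennreal ((?T (insert k I') \<omega>)\<^sup>2) \<partial>PiM (insert k I') R)
        = (\<integral>\<^sup>+\<omega>. \<integral>\<^sup>+r. ennreal ((?T (insert k I') (fun_upd \<omega> k r))\<^sup>2) \<partial>R k \<partial>PiM I' R)"
      by (intro product_nn_integral_insert insert(1,2)) (measurable, erule meas, measurable)
    \<comment> \<open>Adding and subtracting \<open>?S I' \<omega>\<close> gives the inner integral
      the shape of \<open>inc2\<close>, with \<open>a = ?T I' \<omega>\<close> and \<open>s\<close>
      the sum of the rows in \<open>I'\<close>.\<close>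
    also have "\<dots> = (\<integral>\<^sup>+\<omega>. \<integral>\<^sup>+r. ennreal ((?T I' \<omega> + (\<Sum>j\<in>J. ((\<Sum>i\<in>I'. Z i j (\<omega> i)) + Z k j r)\<^sup>2)
        - ?S I' \<omega> - m k)\<^sup>2) \<partial>R k \<partial>PiM I' R)"
      using insert unfolding upd[OF insert(1,2)] by (simp add: algebra_simps)
    also have "\<dots> \<le> (\<integral>\<^sup>+\<omega>. ennreal ((?T I' \<omega>)\<^sup>2 + 8 * \<kappa> * ?S I' \<omega> + 2 * \<mu>) \<partial>PiM I' R)"
      by (intro nn_integral_mono inc2)
    also have "\<dots> = (\<integral>\<^sup>+\<omega>. ennreal ((?T I' \<omega>)\<^sup>2) + ennreal (8 * \<kappa>) * ennreal (?S I' \<omega>) + ennreal (2 * \<mu>) \<partial>PiM I' R)"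
      using \<mu> \<kappa> by (intro nn_integral_cong) (simp add: sum_nonneg ennreal_mult ennreal_plus)
    also have "\<dots> = (\<integral>\<^sup>+\<omega>. ennreal ((?T I' \<omega>)\<^sup>2) \<partial>PiM I' R) + ennreal (8 * \<kappa>) * (\<integral>\<^sup>+\<omega>. ennreal (?S I' \<omega>) \<partial>PiM I' R) + ennreal (2 * \<mu>)"
      using measS prob_space.emeasure_space_1[OF prob_space_PiM[of I' R]] R
      by (simp add: nn_integral_add nn_integral_cmult)
    also have "\<dots> \<le> ennreal (8 * \<kappa> * \<tau> * ?n\<^sup>2 + 2 * \<mu> * ?n) + ennreal (8 * \<kappa>) * ennreal (?n * \<tau>) + ennreal (2 * \<mu>)"
      by (intro add_right_mono add_mono mult_left_mono insert A) auto
    also have "\<dots> = ennreal (8 * \<kappa> * \<tau> * ?n\<^sup>2 + 2 * \<mu> * ?n + 8 * \<kappa> * (?n * \<tau>) + 2 * \<mu>)"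
      using \<mu> \<kappa> \<tau> by (simp add: ennreal_mult ennreal_plus)
    also have "\<dots> \<le> ennreal (8 * \<kappa> * \<tau> * (real (card (insert k I')))\<^sup>2 + 2 * \<mu> * real (card (insert k I')))"
    proof (rule ennreal_leI)
      \<comment> \<open>Passing from n^2 to (n + 1)^2 gains 2 n + 1 where only n is needed; this
        term is the surplus.\<close>
      have "0 \<le> 8 * \<kappa> * \<tau> * (?n + 1)" using \<kappa> \<tau> by auto
      then show "8 * \<kappa> * \<tau> * ?n\<^sup>2 + 2 * \<mu> * ?n + 8 * \<kappa> * (?n * \<tau>) + 2 * \<mu>
        \<le> 8 * \<kappa> * \<tau> * (real (card (insert k I')))\<^sup>2 + 2 * \<mu> * real (card (insert k I'))"
        using insert by (simp add: power2_eq_square algebra_simps)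
    qed
    finally show ?case .
  qed (auto simp: nn_integral_empty)
qed

section \<open>Gaussian moments\<close>

text \<open>The combination is again centred normal, with variance
  \<open>\<Sum>k\<in>K. (c k)\<^sup>2\<close>. The cases \<open>p\<close> = 1, 2, 4 supply the
  constants 1, 3 and 105 used below.\<close>

lemma (in prob_space) std_normal_combination_moment:
  fixes g :: "'k \<Rightarrow> 'a \<Rightarrow> real" and c :: "'k \<Rightarrow> real"
  assumes K: "finite K" and ind: "indep_vars (\<lambda>_. borel) g K"
    and g: "\<And>k. k \<in> K \<Longrightarrow> distributed M lborel (g k) std_normal_density"
  shows "has_bochner_integral M (\<lambda>\<omega>. (\<Sum>k\<in>K. c k * g k \<omega>) ^ (2 * p))
     (fact (2 * p) / (2 ^ p * fact p) * (\<Sum>k\<in>K. (c k)\<^sup>2) ^ p)"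
proof -
  \<comment> \<open>Scaling by 0 destroys the density, so zero coefficients are dropped before the
    normal laws are added; if nothing remains, both sides are powers of 0.\<close>
  let ?K = "{k \<in> K. c k \<noteq> 0}"
  have sum_g: "(\<Sum>k\<in>K. c k * g k \<omega>) = (\<Sum>k\<in>?K. c k * g k \<omega>)" for \<omega>
    using K by (intro sum.mono_neutral_right) auto
  have sum_c: "(\<Sum>k\<in>K. (c k)\<^sup>2) = (\<Sum>k\<in>?K. (c k)\<^sup>2)"
    using K by (intro sum.mono_neutral_right) auto
  show ?thesis
  proof (cases "?K = {}")
    case True
    have "has_bochner_integral M (\<lambda>_. 0 ^ p :: real) (0 ^ p)"
      by (simp add: has_bochner_integral_iff prob_space)
    then show ?thesis unfolding sum_g sum_c True
      by (cases p) simp_all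
  next
    case False
    let ?s = "sqrt (\<Sum>k\<in>?K. (c k)\<^sup>2)"
    have "distributed M lborel (\<lambda>\<omega>. 0 + c k * g k \<omega>) (normal_density (0 + c k * 0) (\<bar>c k\<bar> * 1))"
      if "k \<in> ?K" for k
      using that by (intro normal_density_affine g) auto
    then have "distributed M lborel (\<lambda>\<omega>. \<Sum>k\<in>?K. c k * g k \<omega>)
        (normal_density (\<Sum>k\<in>?K. 0) (sqrt (\<Sum>k\<in>?K. \<bar>c k\<bar>\<^sup>2)))"
      using K False by (intro sum_indep_normal indep_vars_compose2[OF indep_vars_subset[OF ind]]) auto
    then have D: "distributed M lborel (\<lambda>\<omega>. \<Sum>k\<in>?K. c k * g k \<omega>) (normal_density 0 ?s)"
      by simp
    have pos: "0 < (\<Sum>k\<in>?K. (c k)\<^sup>2)" using K False by (intro sum_pos) auto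
    then have "0 < ?s" by simp
    from normal_moment_even[OF this, of 0 p]
    have mom: "integrable lborel (\<lambda>x. normal_density 0 ?s x * x ^ (2 * p))"
      "(\<integral>x. normal_density 0 ?s x * x ^ (2 * p) \<partial>lborel) = fact (2 * p) / ((2 / ?s\<^sup>2) ^ p * fact p)"
      by (simp_all add: has_bochner_integral_iff)
    have "?s\<^sup>2 = (\<Sum>k\<in>?K. (c k)\<^sup>2)" using pos by simp
    then show ?thesis
      unfolding sum_g sum_c has_bochner_integral_iff
      using distributed_integrable[OF D, of "\<lambda>x. x ^ (2 * p)"] distributed_integral[OF D, of "\<lambda>x. x ^ (2 * p)"] mom
      by (simp add: power_divide)
  qed
qed

lemma power4_add_le: "(a + b) ^ 4 \<le> 8 * (a ^ 4 + b ^ 4)" for a b :: real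
proof -
  have "(a + b)\<^sup>2 \<le> 2 * (a\<^sup>2 + b\<^sup>2)"
    using zero_le_power2[of "a - b"] by (simp add: power2_eq_square algebra_simps)
  then have "((a + b)\<^sup>2)\<^sup>2 \<le> (2 * (a\<^sup>2 + b\<^sup>2))\<^sup>2" by (rule power_mono) simp
  also have "\<dots> \<le> 8 * ((a\<^sup>2)\<^sup>2 + (b\<^sup>2)\<^sup>2)"
    using zero_le_power2[of "a\<^sup>2 - b\<^sup>2"] by (simp add: power2_eq_square algebra_simps)
  finally show ?thesis by (simp add: power2_eq_square power4_eq_xxxx algebra_simps)
qed

lemma weighted_am_gm:
  fixes a b t :: real assumes "t > 0"
  shows "a * b \<le> (1 / (2 * t)) * a\<^sup>2 + (t / 2) * b\<^sup>2"
proof -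
  have "0 \<le> (a - t * b)\<^sup>2 / (2 * t)" using assms by simp
  also have "\<dots> = (1 / (2 * t)) * a\<^sup>2 + (t / 2) * b\<^sup>2 - a * b"
    using assms by (simp add: field_simps power2_eq_square)
  finally show ?thesis by simp
qed

context prob_space
begin

text \<open>One row: \<open>Y\<close> is its observation, and \<open>g q * Y\<close> is an unbiased
  estimator of the coefficient \<open>w q\<close> with error \<open>Z q\<close>. Since
  \<open>g q\<close> and \<open>Y\<close> are dependent, products are not factorised but separated
  by the inequality of means, which reduces everything to moments of linear combinations. The
  constant \<open>\<kappa>\<close> does not depend on the size of \<open>J\<close>.\<close>

lemma centred_row_moments:
  fixes g :: "'k \<Rightarrow> 'a \<Rightarrow> real" and w :: "'k \<Rightarrow> real" and J K :: "'k set"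
  defines "Y \<equiv> \<lambda>\<omega>. \<Sum>k\<in>K. w k * g k \<omega>" and "V \<equiv> \<Sum>k\<in>K. (w k)\<^sup>2"
  defines "Z \<equiv> \<lambda>q \<omega>. g q \<omega> * Y \<omega> - w q" and "\<kappa> \<equiv> 3 * (1 + V\<^sup>2) / 2"
  assumes K: "finite K" and ind: "indep_vars (\<lambda>_. borel) g K"
    and g: "\<And>k. k \<in> K \<Longrightarrow> distributed M lborel (g k) std_normal_density"
    and J: "J \<subseteq> K"
  shows "\<And>q. q \<in> J \<Longrightarrow> expectation (Z q) = 0"
    and "\<And>u. expectation (\<lambda>\<omega>. (\<Sum>q\<in>J. u q * Z q \<omega>)\<^sup>2) \<le> \<kappa> * (\<Sum>q\<in>J. (u q)\<^sup>2)"
    and "expectation (\<lambda>\<omega>. \<Sum>q\<in>J. (Z q \<omega>)\<^sup>2) \<le> real (card J) * \<kappa>"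
    and "integrable M (\<lambda>\<omega>. (\<Sum>q\<in>J. (Z q \<omega>)\<^sup>2)\<^sup>2)"
    and "expectation (\<lambda>\<omega>. (\<Sum>q\<in>J. (Z q \<omega>)\<^sup>2)\<^sup>2) \<le> (real (card J))\<^sup>2 * (420 * (1 + V ^ 4) + 8 * V\<^sup>2)"
proof -
  have finJ: "finite J" using J K finite_subset by blast
  have meas [measurable]: "g k \<in> borel_measurable M" if "k \<in> K" for k
    using distributed_measurable[OF g[OF that]] by simp
  have Ym [measurable]: "Y \<in> borel_measurable M" unfolding Y_def by measurable
  have Zm: "Z q \<in> borel_measurable M" if "q \<in> J" for q
    using J that unfolding Z_def by (intro borel_measurable_diff borel_measurable_times Ym meas) auto
  have mom: "has_bochner_integral M (\<lambda>\<omega>. (\<Sum>k\<in>H. c k * g k \<omega>) ^ (2 * p))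
     (fact (2 * p) / (2 ^ p * fact p) * (\<Sum>k\<in>H. (c k)\<^sup>2) ^ p)" if "H \<subseteq> K" for H c p
    using that K by (intro std_normal_combination_moment indep_vars_subset[OF ind] g) (auto intro: finite_subset)
  have mom2: "has_bochner_integral M (\<lambda>\<omega>. (\<Sum>k\<in>H. c k * g k \<omega>)\<^sup>2) (\<Sum>k\<in>H. (c k)\<^sup>2)" if "H \<subseteq> K" for H c
    using mom[OF that, of c 1] by (simp add: fact_numeral)
  have mom4: "has_bochner_integral M (\<lambda>\<omega>. (\<Sum>k\<in>H. c k * g k \<omega>) ^ 4) (3 * (\<Sum>k\<in>H. (c k)\<^sup>2)\<^sup>2)" if "H \<subseteq> K" for H c
    using mom[OF that, of c 2] by (simp add: fact_numeral)
  have mom8: "has_bochner_integral M (\<lambda>\<omega>. (\<Sum>k\<in>H. c k * g k \<omega>) ^ 8) (105 * (\<Sum>k\<in>H. (c k)\<^sup>2) ^ 4)" if "H \<subseteq> K" for H c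
    using mom[OF that, of c 4] by (simp add: fact_numeral)
  have Y4: "has_bochner_integral M (\<lambda>\<omega>. Y \<omega> ^ 4) (3 * V\<^sup>2)"
    and Y8: "has_bochner_integral M (\<lambda>\<omega>. Y \<omega> ^ 8) (105 * V ^ 4)"
    using mom4[of K w] mom8[of K w] by (simp_all add: Y_def V_def)
  have V0: "V \<ge> 0" unfolding V_def by (simp add: sum_nonneg)

  \<comment> \<open>Polarisation:
    \<open>4 * (g q * Y) = (g q + Y)\<^sup>2 - (g q - Y)\<^sup>2\<close>, and both squares are
    squares of linear combinations, to which \<open>mom2\<close> applies in spite of the
    dependence.\<close>
  have gY: "has_bochner_integral M (\<lambda>\<omega>. g q \<omega> * Y \<omega>) (w q)" if q: "q \<in> J" for q
  proof -
    have qK: "q \<in> K" using q J by auto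
    let ?d = "\<lambda>k. if k = q then 1 else 0 :: real"
    have sg: "(\<Sum>k\<in>K. (?d k + s * w k) * g k \<omega>) = g q \<omega> + s * Y \<omega>" for s \<omega>
      using K qK by (simp add: Y_def distrib_right sum.distrib sum_distrib_left mult.assoc if_distrib[of "\<lambda>a. a * _"] cong: if_cong)
    have "(?d k + s * w k)\<^sup>2 = (if k = q then 1 + 2 * s * w q else 0) + s\<^sup>2 * (w k)\<^sup>2" for s k
      by (simp add: power2_eq_square algebra_simps)
    then have sd: "(\<Sum>k\<in>K. (?d k + s * w k)\<^sup>2) = 1 + 2 * s * w q + s\<^sup>2 * V" for s
      using K qK by (simp add: V_def sum.distrib sum_distrib_left)
    have polar: "has_bochner_integral M (\<lambda>\<omega>. (g q \<omega> + s * Y \<omega>)\<^sup>2) (1 + 2 * s * w q + s\<^sup>2 * V)" for s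
      using mom2[of K "\<lambda>k. ?d k + s * w k"] unfolding sg sd by simp
    from has_bochner_integral_diff[OF polar[of 1] polar[of "-1"], THEN has_bochner_integral_mult_left[of "1/4"]]
    show ?thesis by (simp add: power2_eq_square algebra_simps)
  qed
  show mean: "expectation (Z q) = 0" if "q \<in> J" for q
    using gY[OF that] by (simp add: Z_def has_bochner_integral_iff prob_space)

  show quad: "expectation (\<lambda>\<omega>. (\<Sum>q\<in>J. u q * Z q \<omega>)\<^sup>2) \<le> \<kappa> * (\<Sum>q\<in>J. (u q)\<^sup>2)" for u
  proof (cases "(\<Sum>q\<in>J. (u q)\<^sup>2) = 0")
    case True
    then have "\<forall>q\<in>J. u q = 0" using finJ by (simp add: sum_nonneg_eq_0_iff)
    then have "(\<Sum>q\<in>J. u q * Z q \<omega>) = 0" for \<omega> by simp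
    then show ?thesis using True by simp
  next
    case False
    \<comment> \<open>\<open>t\<close> is the variance of \<open>?F\<close> and also the weight in
      \<open>weighted_am_gm\<close>. With the fourth moments 3 t^2 and 3 V^2 both terms of the bound
      become linear in \<open>t\<close>, as a bound on a quadratic form in \<open>u\<close>
      requires.\<close>
    define t where "t = (\<Sum>q\<in>J. (u q)\<^sup>2)"
    have t: "t > 0" using False unfolding t_def by (simp add: order_less_le sum_nonneg)
    let ?F = "\<lambda>\<omega>. \<Sum>q\<in>J. u q * g q \<omega>"
    let ?X = "\<lambda>\<omega>. ?F \<omega> * Y \<omega>"
    have F4: "has_bochner_integral M (\<lambda>\<omega>. ?F \<omega> ^ 4) (3 * t\<^sup>2)"
      using mom4[OF J, of u] by (simp add: t_def)
    have bnd: "has_bochner_integral M (\<lambda>\<omega>. (1 / (2 * t)) * ?F \<omega> ^ 4 + (t / 2) * Y \<omega> ^ 4)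
       ((1 / (2 * t)) * (3 * t\<^sup>2) + (t / 2) * (3 * V\<^sup>2))"
      by (intro has_bochner_integral_add has_bochner_integral_mult_right F4 Y4)
    have X2le: "(?X \<omega>)\<^sup>2 \<le> (1 / (2 * t)) * ?F \<omega> ^ 4 + (t / 2) * Y \<omega> ^ 4" for \<omega>
      using weighted_am_gm[OF t, of "(?F \<omega>)\<^sup>2" "(Y \<omega>)\<^sup>2"] by (simp add: power_mult_distrib flip: power_mult)
    have Xm: "?X \<in> borel_measurable M"
      using J by (intro borel_measurable_times borel_measurable_sum Ym) auto
    have intX2: "integrable M (\<lambda>\<omega>. (?X \<omega>)\<^sup>2)"
      by (rule integrable_nonneg_bound[OF integrable.intros[OF bnd] borel_measurable_power[OF Xm] _ X2le]) simp
    have intX: "integrable M ?X" using Xm intX2 by (rule square_integrable_imp_integrable)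
    have "has_bochner_integral M (\<lambda>\<omega>. \<Sum>q\<in>J. u q * (g q \<omega> * Y \<omega>)) (\<Sum>q\<in>J. u q * w q)"
      using gY by (intro has_bochner_integral_sum has_bochner_integral_mult_right)
    then have EX: "expectation ?X = (\<Sum>q\<in>J. u q * w q)"
      by (simp add: has_bochner_integral_iff sum_distrib_right mult.assoc)
    have "(\<Sum>q\<in>J. u q * Z q \<omega>) = ?X \<omega> - expectation ?X" for \<omega>
      unfolding EX by (simp add: Z_def sum_distrib_right sum_subtractf right_diff_distrib mult.assoc)
    then have "expectation (\<lambda>\<omega>. (\<Sum>q\<in>J. u q * Z q \<omega>)\<^sup>2) = expectation (\<lambda>\<omega>. (?X \<omega>)\<^sup>2) - (expectation ?X)\<^sup>2"
      using variance_eq[OF intX intX2] by simp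
    also have "\<dots> \<le> expectation (\<lambda>\<omega>. (?X \<omega>)\<^sup>2)" by simp
    also have "\<dots> \<le> expectation (\<lambda>\<omega>. (1 / (2 * t)) * ?F \<omega> ^ 4 + (t / 2) * Y \<omega> ^ 4)"
      using bnd by (intro integral_mono intX2 X2le) (rule integrable.intros)
    also have "\<dots> = (1 / (2 * t)) * (3 * t\<^sup>2) + (t / 2) * (3 * V\<^sup>2)"
      using bnd by (rule has_bochner_integral_integral_eq)
    also have "\<dots> = \<kappa> * t" using t by (simp add: \<kappa>_def field_simps power2_eq_square)
    finally show ?thesis by (simp add: t_def)
  qed

  \<comment> \<open>Combines (a + b)^4 \<le> 8 (a^4 + b^4), then (g Y)^4 \<le> (g^8 + Y^8) / 2, then
    w^4 \<le> V^2. The eighth moments 105 and 105 V^4 turn the factor 4 into 420.\<close>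
  let ?b = "\<lambda>q \<omega>. 4 * (g q \<omega> ^ 8 + Y \<omega> ^ 8) + 8 * V\<^sup>2"
  have Z4le: "(Z q \<omega>) ^ 4 \<le> ?b q \<omega>" if "q \<in> J" for q \<omega>
  proof -
    have "(w q)\<^sup>2 \<le> V" unfolding V_def using that J K by (intro member_le_sum) auto
    then have "((w q)\<^sup>2)\<^sup>2 \<le> V\<^sup>2" by (rule power_mono) simp
    moreover have "(g q \<omega> * Y \<omega>) ^ 4 \<le> (g q \<omega> ^ 8 + Y \<omega> ^ 8) / 2"
      using zero_le_power2[of "g q \<omega> ^ 4 - Y \<omega> ^ 4"]
      by (simp add: power2_diff power_mult_distrib flip: power_mult)
    moreover have "(Z q \<omega>) ^ 4 \<le> 8 * ((g q \<omega> * Y \<omega>) ^ 4 + (- w q) ^ 4)"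
      unfolding Z_def using power4_add_le[of "g q \<omega> * Y \<omega>" "- w q"] by simp
    ultimately show ?thesis by (simp flip: power_mult)
  qed
  have bint: "has_bochner_integral M (?b q) (420 * (1 + V ^ 4) + 8 * V\<^sup>2)" if "q \<in> J" for q
  proof -
    have "has_bochner_integral M (\<lambda>\<omega>. g q \<omega> ^ 8) 105"
      using mom8[of "{q}" "\<lambda>_. 1"] that J by (simp add: subset_iff)
    then have "has_bochner_integral M (?b q) (4 * (105 + 105 * V ^ 4) + 8 * V\<^sup>2)"
      by (intro has_bochner_integral_add has_bochner_integral_mult_right Y8) (auto simp: has_bochner_integral_iff prob_space)
    then show ?thesis by simp
  qed
  have Z4int: "integrable M (\<lambda>\<omega>. Z q \<omega> ^ 4)" if "q \<in> J" for q
    by (rule integrable_nonneg_bound[OF integrable.intros[OF bint[OF that]] borel_measurable_power[OF Zm[OF that]] _ Z4le[OF that]]) simp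
  let ?S = "\<lambda>\<omega>. (\<Sum>q\<in>J. (Z q \<omega>)\<^sup>2)\<^sup>2"
  have S_le: "?S \<omega> \<le> real (card J) * (\<Sum>q\<in>J. (Z q \<omega>) ^ 4)" for \<omega>
    using Cauchy_Schwarz_ineq_sum[of "\<lambda>_. 1" "\<lambda>q. (Z q \<omega>)\<^sup>2" J] by (simp flip: power_mult)
  have bigint: "integrable M (\<lambda>\<omega>. real (card J) * (\<Sum>q\<in>J. (Z q \<omega>) ^ 4))"
    by (intro integrable_mult_right Bochner_Integration.integrable_sum Z4int)
  show Sint: "integrable M ?S"
    by (rule integrable_nonneg_bound[OF bigint _ _ S_le]) (auto intro!: borel_measurable_power borel_measurable_sum Zm)
  have "expectation ?S \<le> expectation (\<lambda>\<omega>. real (card J) * (\<Sum>q\<in>J. (Z q \<omega>) ^ 4))"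
    by (rule integral_mono[OF Sint bigint S_le])
  also have "\<dots> = real (card J) * (\<Sum>q\<in>J. expectation (\<lambda>\<omega>. (Z q \<omega>) ^ 4))"
    using Z4int by simp
  also have "(\<Sum>q\<in>J. expectation (\<lambda>\<omega>. (Z q \<omega>) ^ 4)) \<le> (\<Sum>q\<in>J. 420 * (1 + V ^ 4) + 8 * V\<^sup>2)"
  proof (rule sum_mono)
    fix q assume q: "q \<in> J"
    have "expectation (\<lambda>\<omega>. (Z q \<omega>) ^ 4) \<le> expectation (?b q)"
      by (intro integral_mono Z4int[OF q] Z4le[OF q] integrable.intros[OF bint[OF q]])
    then show "expectation (\<lambda>\<omega>. (Z q \<omega>) ^ 4) \<le> 420 * (1 + V ^ 4) + 8 * V\<^sup>2"
      unfolding has_bochner_integral_integral_eq[OF bint[OF q]] .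
  qed
  finally show "expectation ?S \<le> (real (card J))\<^sup>2 * (420 * (1 + V ^ 4) + 8 * V\<^sup>2)"
    by (simp add: power2_eq_square mult_left_mono mult.assoc)

  have Z2: "integrable M (\<lambda>\<omega>. (Z q \<omega>)\<^sup>2) \<and> expectation (\<lambda>\<omega>. (Z q \<omega>)\<^sup>2) \<le> \<kappa>" if q: "q \<in> J" for q
  proof
    have "integrable M (\<lambda>\<omega>. ((Z q \<omega>)\<^sup>2)\<^sup>2)" using Z4int[OF q] by (simp flip: power_mult)
    then show "integrable M (\<lambda>\<omega>. (Z q \<omega>)\<^sup>2)"
      by (rule square_integrable_imp_integrable[rotated]) (intro borel_measurable_power Zm q)
    \<comment> \<open>The variance of one coordinate is the quadratic form at a unit vector.\<close>
    have "(\<Sum>k\<in>J. (if k = q then 1 else 0) * Z k \<omega>) = Z q \<omega>" for \<omega>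
      using q finJ by (simp add: if_distrib[of "\<lambda>a. a * _"] cong: if_cong)
    moreover have "(\<Sum>k\<in>J. (if k = q then 1 else 0 :: real)\<^sup>2) = 1"
      using q finJ by (simp add: if_distrib[of "\<lambda>a. a\<^sup>2"] cong: if_cong)
    ultimately show "expectation (\<lambda>\<omega>. (Z q \<omega>)\<^sup>2) \<le> \<kappa>"
      using quad[of "\<lambda>k. if k = q then 1 else 0"] by simp
  qed
  have "expectation (\<lambda>\<omega>. \<Sum>q\<in>J. (Z q \<omega>)\<^sup>2) = (\<Sum>q\<in>J. expectation (\<lambda>\<omega>. (Z q \<omega>)\<^sup>2))"
    using Z2 by (intro Bochner_Integration.integral_sum) auto
  also have "\<dots> \<le> real (card J) * \<kappa>" using Z2 by (intro sum_bounded_above) auto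
  finally show "expectation (\<lambda>\<omega>. \<Sum>q\<in>J. (Z q \<omega>)\<^sup>2) \<le> real (card J) * \<kappa>" .
qed

end

text \<open>The joint law of independent random vectors is the product of their laws, so the
  estimate for product measures transfers along the map that collects all rows.\<close>

lemma (in prob_space) second_moment_squared_norm_indep:
  fixes Z :: "nat \<Rightarrow> 'j \<Rightarrow> 'a \<Rightarrow> real" and J :: "'j set"
  defines "m \<equiv> \<lambda>i. expectation (\<lambda>\<omega>. \<Sum>j\<in>J. (Z i j \<omega>)\<^sup>2)"
  assumes ind: "indep_vars (\<lambda>_. \<Pi>\<^sub>M j\<in>J. borel) (\<lambda>i \<omega>. \<lambda>j\<in>J. Z i j \<omega>) I"
    and I: "finite I" "I \<noteq> {}" and J: "finite J"
    and int: "\<And>i. i \<in> I \<Longrightarrow> integrable M (\<lambda>\<omega>. (\<Sum>j\<in>J. (Z i j \<omega>)\<^sup>2)\<^sup>2)"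
    and mean: "\<And>i j. i \<in> I \<Longrightarrow> j \<in> J \<Longrightarrow> expectation (Z i j) = 0"
    and quad: "\<And>i u. i \<in> I \<Longrightarrow> expectation (\<lambda>\<omega>. (\<Sum>j\<in>J. u j * Z i j \<omega>)\<^sup>2) \<le> \<kappa> * (\<Sum>j\<in>J. (u j)\<^sup>2)"
    and four: "\<And>i. i \<in> I \<Longrightarrow> expectation (\<lambda>\<omega>. (\<Sum>j\<in>J. (Z i j \<omega>)\<^sup>2)\<^sup>2) \<le> \<mu>"
    and m: "\<And>i. i \<in> I \<Longrightarrow> m i \<le> \<tau>" and \<kappa>: "\<kappa> \<ge> 0"
  shows "(\<integral>\<^sup>+\<omega>. ennreal (((\<Sum>j\<in>J. (\<Sum>i\<in>I. Z i j \<omega>)\<^sup>2) - (\<Sum>i\<in>I. m i))\<^sup>2) \<partial>M)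
           \<le> ennreal (8 * \<kappa> * \<tau> * (real (card I))\<^sup>2 + 2 * \<mu> * real (card I))"
proof -
  obtain i0 where i0: "i0 \<in> I" using I by auto
  \<comment> \<open>The product estimate asks for a probability measure at every natural number;
    indices outside \<open>I\<close> receive the law of row \<open>i0\<close>.\<close>
  define c where "c i = (if i \<in> I then i else i0)" for i
  have c: "c i \<in> I" for i using i0 by (simp add: c_def)
  let ?B = "\<Pi>\<^sub>M j\<in>J. borel :: real measure"
  let ?X = "\<lambda>i \<omega>. \<lambda>j\<in>J. Z i j \<omega>"
  have X: "?X i \<in> M \<rightarrow>\<^sub>M ?B" if "i \<in> I" for i
    using ind that unfolding indep_vars_def by auto
  define R where "R i = distr M ?B (?X (c i))" for i
  have distr: "(\<integral>r. f r \<partial>R i) = expectation (\<lambda>\<omega>. f (?X (c i) \<omega>))"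
    if "f \<in> borel_measurable ?B" for f :: "('j \<Rightarrow> real) \<Rightarrow> real" and i
    unfolding R_def by (rule integral_distr[OF X[OF c] that])
  have q1: "(\<lambda>r. \<Sum>j\<in>J. (r j)\<^sup>2) \<in> borel_measurable ?B" by measurable
  have q2: "(\<lambda>r. (\<Sum>j\<in>J. (r j)\<^sup>2)\<^sup>2) \<in> borel_measurable ?B" by measurable
  have q3: "(\<lambda>r. (\<Sum>j\<in>J. u j * r j)\<^sup>2) \<in> borel_measurable ?B" for u by measurable
  have R: "prob_space (R i)" for i unfolding R_def by (intro prob_space_distr X c)
  have setsR: "sets (R i) = sets ?B" for i by (simp add: R_def)
  have mR: "(\<integral>r. (\<Sum>j\<in>J. (r j)\<^sup>2) \<partial>R i) = m (c i)" for i
    unfolding m_def distr[OF q1] by simp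
  have main: "(\<integral>\<^sup>+r. ennreal (((\<Sum>j\<in>J. (\<Sum>i\<in>I. r i j)\<^sup>2) - (\<Sum>i\<in>I. \<integral>r. (\<Sum>j\<in>J. (r j)\<^sup>2) \<partial>R i))\<^sup>2) \<partial>PiM I R)
           \<le> ennreal (8 * \<kappa> * \<tau> * (real (card I))\<^sup>2 + 2 * \<mu> * real (card I))"
  proof (rule second_moment_squared_norm_PiM[where Z="\<lambda>i j r. r j" and R=R])
    show "(\<lambda>r. r j) \<in> borel_measurable (R i)" if "j \<in> J" for i j
      using that unfolding measurable_cong_sets[OF setsR refl] by measurable
    show "integrable (R i) (\<lambda>r. (\<Sum>j\<in>J. (r j)\<^sup>2)\<^sup>2)" for i
      unfolding R_def using int[OF c[of i]] by (subst integrable_distr_eq[OF X[OF c] q2]) simp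
    show "(\<integral>r. r j \<partial>R i) = 0" if "j \<in> J" for i j
      using mean[OF c that, of i] that by (subst distr) auto
    show "(\<integral>r. (\<Sum>j\<in>J. u j * r j)\<^sup>2 \<partial>R i) \<le> \<kappa> * (\<Sum>j\<in>J. (u j)\<^sup>2)" for i u
      using quad[OF c, of u i] unfolding distr[OF q3] by simp
    show "(\<integral>r. (\<Sum>j\<in>J. (r j)\<^sup>2)\<^sup>2 \<partial>R i) \<le> \<mu>" for i
      using four[OF c, of i] unfolding distr[OF q2] by simp
    show "(\<integral>r. (\<Sum>j\<in>J. (r j)\<^sup>2) \<partial>R i) \<le> \<tau>" for i
      unfolding mR by (rule m[OF c])
  qed (use R J I \<kappa> in auto)
  let ?T = "\<lambda>\<omega>. \<lambda>i\<in>I. ?X i \<omega>"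
  have T: "?T \<in> M \<rightarrow>\<^sub>M PiM I (\<lambda>_. ?B)" by (intro measurable_restrict X)
  have "distr M (PiM I (\<lambda>_. ?B)) ?T = PiM I (\<lambda>i. distr M ?B (?X i))"
    using ind X by (subst (asm) indep_vars_iff_distr_eq_PiM'[OF I(2)]) auto
  also have "\<dots> = PiM I R" by (intro PiM_cong) (auto simp: R_def c_def)
  finally have PR: "PiM I R = distr M (PiM I (\<lambda>_. ?B)) ?T" ..
  have sm: "(\<Sum>i\<in>I. \<integral>r. (\<Sum>j\<in>J. (r j)\<^sup>2) \<partial>R i) = (\<Sum>i\<in>I. m i)"
    unfolding mR by (intro sum.cong) (auto simp: c_def)
  have comp: "(\<lambda>r. r i j) \<in> borel_measurable (PiM I (\<lambda>_. ?B))" if "i \<in> I" "j \<in> J" for i j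
    by (rule measurable_compose[OF measurable_component_singleton[OF that(1), of "\<lambda>_. ?B"] measurable_component_singleton[OF that(2)]])
  have fm: "(\<lambda>r. ennreal (((\<Sum>j\<in>J. (\<Sum>i\<in>I. r i j)\<^sup>2) - (\<Sum>i\<in>I. m i))\<^sup>2)) \<in> borel_measurable (PiM I (\<lambda>_. ?B))"
    by (intro measurable_compose[OF _ measurable_ennreal] borel_measurable_power borel_measurable_diff borel_measurable_sum
       borel_measurable_const comp)
  show ?thesis
    using main unfolding sm PR by (subst (asm) nn_integral_distr[OF T]) (simp_all add: fm cong: sum.cong)
qed

section \<open>The Gaussian model\<close>

abbreviation normal_law :: "real \<Rightarrow> real measure" where
  "normal_law v \<equiv> density lborel (\<lambda>t. ennreal (normal_density 0 (sqrt (v / 2)) t))"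

lemma prob_space_normal_law: "v > 0 \<Longrightarrow> prob_space (normal_law v)"
  by (rule prob_space_normal_density) simp

lemma sets_complex_gaussian [measurable_cong]: "sets (complex_gaussian v) = sets borel"
  by (simp add: complex_gaussian_def Let_def)

lemma measurable_Complex [measurable]: "(\<lambda>(a, b). Complex a b) \<in> borel \<Otimes>\<^sub>M borel \<rightarrow>\<^sub>M borel"
proof -
  have "(\<lambda>(a, b). Complex a b) = (\<lambda>p. complex_of_real (fst p) + \<i> * complex_of_real (snd p))"
    by (auto simp: complex_eq_iff)
  then show ?thesis by simp
qed

lemma prob_space_complex_gaussian:
  assumes "v > 0" shows "prob_space (complex_gaussian v)"
proof -
  interpret G: prob_space "normal_law v" using assms by (rule prob_space_normal_law)
  interpret GG: pair_prob_space "normal_law v" "normal_law v" ..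
  have "(\<lambda>(a, b). Complex a b) \<in> normal_law v \<Otimes>\<^sub>M normal_law v \<rightarrow>\<^sub>M borel"
    using measurable_Complex by (simp cong: measurable_cong_sets sets_pair_measure_cong)
  then show ?thesis
    unfolding complex_gaussian_def Let_def by (rule GG.prob_space_distr)
qed

lemma emeasure_complex_gaussian_rectangle:
  assumes v: "v > 0" and [measurable]: "E \<in> sets borel" "F \<in> sets borel"
  shows "emeasure (complex_gaussian v) {z. Re z \<in> E \<and> Im z \<in> F} =
    emeasure (normal_law v) E * emeasure (normal_law v) F"
proof -
  interpret G: prob_space "normal_law v" using v by (rule prob_space_normal_law)
  have m: "(\<lambda>(a, b). Complex a b) \<in> normal_law v \<Otimes>\<^sub>M normal_law v \<rightarrow>\<^sub>M borel"
    using measurable_Complex by (simp cong: measurable_cong_sets sets_pair_measure_cong)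
  have "emeasure (complex_gaussian v) {z. Re z \<in> E \<and> Im z \<in> F}
      = emeasure (normal_law v \<Otimes>\<^sub>M normal_law v) ((\<lambda>(a, b). Complex a b) -` {z. Re z \<in> E \<and> Im z \<in> F}
          \<inter> space (normal_law v \<Otimes>\<^sub>M normal_law v))"
    unfolding complex_gaussian_def Let_def by (rule emeasure_distr[OF m]) simp
  also have "(\<lambda>(a, b). Complex a b) -` {z. Re z \<in> E \<and> Im z \<in> F} \<inter> space (normal_law v \<Otimes>\<^sub>M normal_law v) = E \<times> F"
    by (auto simp: space_pair_measure)
  also have "emeasure (normal_law v \<Otimes>\<^sub>M normal_law v) (E \<times> F) = emeasure (normal_law v) E * emeasure (normal_law v) F"
    by (rule G.emeasure_pair_measure_Times) auto
  finally show ?thesis .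
qed

definition model :: "nat \<Rightarrow> nat \<Rightarrow> real \<Rightarrow> ((nat \<times> nat \<Rightarrow> complex) \<times> (nat \<Rightarrow> complex)) measure" where
  "model N M \<nu> = gaussian_matrix N M \<Otimes>\<^sub>M gaussian_noise N \<nu>"

text \<open>The noise is treated as a column with index \<open>0\<close> of the matrix.\<close>

definition entry :: "(nat \<times> nat \<Rightarrow> complex) \<times> (nat \<Rightarrow> complex) \<Rightarrow> nat \<times> nat \<Rightarrow> complex" where
  "entry \<omega> p = (if snd p = 0 then snd \<omega> (fst p) else fst \<omega> p)"

definition entry_part :: "(nat \<times> nat) \<times> bool \<Rightarrow> (nat \<times> nat \<Rightarrow> complex) \<times> (nat \<Rightarrow> complex) \<Rightarrow> real" where
  "entry_part k \<omega> = (if snd k then Re (entry \<omega> (fst k)) else Im (entry \<omega> (fst k)))"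

definition entry_var :: "real \<Rightarrow> nat \<times> nat \<Rightarrow> real" where
  "entry_var \<nu> p = (if snd p = 0 then \<nu>\<^sup>2 else 1)"

abbreviation entry_indices :: "nat \<Rightarrow> nat \<Rightarrow> ((nat \<times> nat) \<times> bool) set" where
  "entry_indices N M \<equiv> ({1..N} \<times> {0..M}) \<times> UNIV"

section \<open>The joint law of all matrix and noise entries\<close>

lemma prob_space_gaussian_matrix: "prob_space (gaussian_matrix N M)"
  unfolding gaussian_matrix_def by (intro prob_space_PiM prob_space_complex_gaussian) simp

lemma prob_space_gaussian_noise: "\<nu> > 0 \<Longrightarrow> prob_space (gaussian_noise N \<nu>)"
  unfolding gaussian_noise_def by (intro prob_space_PiM prob_space_complex_gaussian) simp

lemma prob_space_model: "\<nu> > 0 \<Longrightarrow> prob_space (model N M \<nu>)"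
  unfolding model_def by (intro prob_space_pair prob_space_gaussian_matrix prob_space_gaussian_noise)

lemma sets_gaussian_matrix [measurable_cong]: "sets (gaussian_matrix N M) = sets (mat_space N M)"
  unfolding gaussian_matrix_def mat_space_def by (intro sets_PiM_cong refl sets_complex_gaussian)

lemma sets_gaussian_noise [measurable_cong]: "sets (gaussian_noise N \<nu>) = sets (vec_space N)"
  unfolding gaussian_noise_def vec_space_def by (intro sets_PiM_cong refl sets_complex_gaussian)

lemma measurable_entry:
  assumes "p \<in> {1..N} \<times> {0..M}"
  shows "(\<lambda>\<omega>. entry \<omega> p) \<in> borel_measurable (model N M \<nu>)"
proof -
  have "fst p \<in> {1..N}" using assms by auto
  then have "(\<lambda>\<omega>. snd \<omega> (fst p)) \<in> borel_measurable (model N M \<nu>)"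
    unfolding model_def gaussian_noise_def by measurable
  moreover have "(\<lambda>\<omega>. fst \<omega> p) \<in> borel_measurable (model N M \<nu>)" if "snd p \<noteq> 0"
  proof -
    have "p \<in> {1..N} \<times> {1..M}" using assms that by auto
    then show ?thesis unfolding model_def gaussian_matrix_def by measurable
  qed
  ultimately show ?thesis by (cases "snd p = 0") (auto simp: entry_def)
qed

lemma measurable_entry_part:
  assumes "k \<in> entry_indices N M"
  shows "entry_part k \<in> borel_measurable (model N M \<nu>)"
proof -
  have [measurable]: "(\<lambda>\<omega>. entry \<omega> (fst k)) \<in> borel_measurable (model N M \<nu>)"
    using assms by (intro measurable_entry) auto
  show ?thesis unfolding entry_part_def[abs_def] by measurable
qed

text \<open>The source of both the marginal laws and the independence of the real entries. The event
  splits into a condition on the matrix and one on the noise; each is a product over complex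
  entries, and each complex entry is a product over its real and imaginary part.\<close>

lemma emeasure_model_rectangle:
  assumes \<nu>: "\<nu> > 0" and E: "\<And>k. E k \<in> sets borel"
  shows "emeasure (model N M \<nu>) {\<omega> \<in> space (model N M \<nu>). \<forall>k\<in>entry_indices N M. entry_part k \<omega> \<in> E k} =
    (\<Prod>k\<in>entry_indices N M. emeasure (normal_law (entry_var \<nu> (fst k))) (E k))"
proof -
  let ?C = "\<lambda>p. {z. Re z \<in> E (p, True) \<and> Im z \<in> E (p, False)}"
  have C [measurable]: "?C p \<in> sets borel" for p
    using E[of "(p, True)"] E[of "(p, False)"] by measurable
  let ?A = "{A \<in> space (gaussian_matrix N M). \<forall>p\<in>{1..N} \<times> {1..M}. A p \<in> ?C p}"
  let ?B = "{n \<in> space (gaussian_noise N \<nu>). \<forall>i\<in>{1..N}. n i \<in> ?C (i, 0)}"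
  interpret mat: product_prob_space "\<lambda>_::nat \<times> nat. complex_gaussian 1" "{1..N} \<times> {1..M}"
    by (intro product_prob_spaceI prob_space_complex_gaussian) simp
  interpret noise: product_prob_space "\<lambda>_::nat. complex_gaussian (\<nu>\<^sup>2)" "{1..N}"
    using \<nu> by (intro product_prob_spaceI prob_space_complex_gaussian) simp
  interpret noise': prob_space "gaussian_noise N \<nu>" using \<nu> by (rule prob_space_gaussian_noise)
  have "{\<omega> \<in> space (model N M \<nu>). \<forall>k\<in>entry_indices N M. entry_part k \<omega> \<in> E k} = ?A \<times> ?B"
  proof (intro set_eqI)
    fix \<omega> :: "(nat \<times> nat \<Rightarrow> complex) \<times> (nat \<Rightarrow> complex)"
    have "(\<forall>k\<in>entry_indices N M. entry_part k \<omega> \<in> E k) \<longleftrightarrow> (\<forall>i\<in>{1..N}. \<forall>j\<in>{0..M}. entry \<omega> (i, j) \<in> ?C (i, j))"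
      by (auto simp: entry_part_def all_bool_eq)
    also have "\<dots> \<longleftrightarrow> (\<forall>p\<in>{1..N} \<times> {1..M}. fst \<omega> p \<in> ?C p) \<and> (\<forall>i\<in>{1..N}. snd \<omega> i \<in> ?C (i, 0))"
      (is "?l \<longleftrightarrow> ?r")
    proof
      assume l: ?l
      have "fst \<omega> (i, j) \<in> ?C (i, j)" if "i \<in> {1..N}" "j \<in> {1..M}" for i j
        using l[rule_format, of i j] that by (simp add: entry_def)
      moreover have "snd \<omega> i \<in> ?C (i, 0)" if "i \<in> {1..N}" for i
        using l[rule_format, of i 0] that by (simp add: entry_def)
      ultimately show ?r by blast
    next
      assume r: ?r
      show ?l
      proof (intro ballI)
        fix i j assume "i \<in> {1..N}" "j \<in> {0..M}"
        then show "entry \<omega> (i, j) \<in> ?C (i, j)"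
          using r by (cases "j = 0") (auto simp: entry_def)
      qed
    qed
    finally show "\<omega> \<in> {\<omega> \<in> space (model N M \<nu>). \<forall>k\<in>entry_indices N M. entry_part k \<omega> \<in> E k} \<longleftrightarrow> \<omega> \<in> ?A \<times> ?B"
      unfolding mem_Collect_eq model_def space_pair_measure mem_Times_iff by (simp only: conj_ac)
  qed
  moreover have "emeasure (model N M \<nu>) (?A \<times> ?B) = emeasure (gaussian_matrix N M) ?A * emeasure (gaussian_noise N \<nu>) ?B"
    unfolding model_def
  proof (rule noise'.emeasure_pair_measure_Times)
    show "?A \<in> sets (gaussian_matrix N M)"
      unfolding gaussian_matrix_def using C by measurable
    show "?B \<in> sets (gaussian_noise N \<nu>)"
      unfolding gaussian_noise_def using C by measurable
  qed
  moreover have "emeasure (gaussian_matrix N M) ?A = (\<Prod>p\<in>{1..N} \<times> {1..M}. emeasure (complex_gaussian 1) (?C p))"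
    unfolding gaussian_matrix_def
    by (rule mat.emeasure_PiM_Collect[THEN trans[rotated]]) auto
  moreover have "emeasure (gaussian_noise N \<nu>) ?B = (\<Prod>i\<in>{1..N}. emeasure (complex_gaussian (\<nu>\<^sup>2)) (?C (i, 0)))"
    unfolding gaussian_noise_def
    by (rule noise.emeasure_PiM_Collect[THEN trans[rotated]]) auto
  moreover have "(\<Prod>k\<in>entry_indices N M. emeasure (normal_law (entry_var \<nu> (fst k))) (E k))
      = (\<Prod>p\<in>{1..N} \<times> {0..M}. emeasure (complex_gaussian (entry_var \<nu> p)) (?C p))"
  proof -
    have "(\<Prod>k\<in>entry_indices N M. emeasure (normal_law (entry_var \<nu> (fst k))) (E k))
       = (\<Prod>p\<in>{1..N} \<times> {0..M}. \<Prod>b\<in>UNIV. emeasure (normal_law (entry_var \<nu> p)) (E (p, b)))"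
      by (subst prod.cartesian_product) (auto intro!: prod.cong)
    also have "\<dots> = (\<Prod>p\<in>{1..N} \<times> {0..M}. emeasure (complex_gaussian (entry_var \<nu> p)) (?C p))"
      using \<nu> E by (intro prod.cong refl)
        (subst emeasure_complex_gaussian_rectangle, auto simp: entry_var_def UNIV_bool mult.commute)
    finally show ?thesis .
  qed
  moreover have "(\<Prod>p\<in>{1..N} \<times> {0..M}. emeasure (complex_gaussian (entry_var \<nu> p)) (?C p))
      = (\<Prod>p\<in>{1..N} \<times> {1..M}. emeasure (complex_gaussian 1) (?C p)) * (\<Prod>i\<in>{1..N}. emeasure (complex_gaussian (\<nu>\<^sup>2)) (?C (i, 0)))"
  proof -
    have split: "{1..N} \<times> {0..M} = {1..N} \<times> {1..M} \<union> (\<lambda>i. (i, 0)) ` {1..N}" by force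
    show ?thesis unfolding split
      by (subst prod.union_disjoint) (auto simp: prod.reindex inj_on_def entry_var_def intro!: arg_cong2[where f="(*)"] prod.cong)
  qed
  ultimately show ?thesis by (simp only:)
qed

lemma emeasure_model_entry_part:
  assumes \<nu>: "\<nu> > 0" and k: "k \<in> entry_indices N M" and E: "E \<in> sets borel"
  shows "emeasure (model N M \<nu>) (entry_part k -` E \<inter> space (model N M \<nu>)) =
    emeasure (normal_law (entry_var \<nu> (fst k))) E"
proof -
  \<comment> \<open>All sides of the rectangle except the one at \<open>k\<close> are the whole line
    and contribute the factor 1.\<close>
  let ?E = "\<lambda>l. if l = k then E else UNIV"
  have v: "entry_var \<nu> p > 0" for p using \<nu> by (simp add: entry_var_def)
  have "entry_part k -` E \<inter> space (model N M \<nu>) =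
      {\<omega> \<in> space (model N M \<nu>). \<forall>l\<in>entry_indices N M. entry_part l \<omega> \<in> ?E l}"
    using k by (auto split: if_splits)
  then have "emeasure (model N M \<nu>) (entry_part k -` E \<inter> space (model N M \<nu>)) =
      (\<Prod>l\<in>entry_indices N M. emeasure (normal_law (entry_var \<nu> (fst l))) (?E l))"
    using emeasure_model_rectangle[OF \<nu>, of ?E N M] E by simp
  also have "\<dots> = (\<Prod>l\<in>entry_indices N M. if l = k then emeasure (normal_law (entry_var \<nu> (fst k))) E else 1)"
    using prob_space.emeasure_space_1[OF prob_space_normal_law[OF v]] by (intro prod.cong refl) simp
  also have "\<dots> = emeasure (normal_law (entry_var \<nu> (fst k))) E"
    using k by (subst prod.delta) auto
  finally show ?thesis .
qed

lemma distributed_entry_part: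
  assumes "\<nu> > 0" and "k \<in> entry_indices N M"
  shows "distributed (model N M \<nu>) lborel (entry_part k) (normal_density 0 (sqrt (entry_var \<nu> (fst k) / 2)))"
  unfolding distributed_def
proof (intro conjI)
  have m: "entry_part k \<in> borel_measurable (model N M \<nu>)" by (rule measurable_entry_part[OF assms(2)])
  then show "entry_part k \<in> model N M \<nu> \<rightarrow>\<^sub>M lborel" by simp
  show "distr (model N M \<nu>) lborel (entry_part k) = normal_law (entry_var \<nu> (fst k))"
    using m emeasure_model_entry_part[OF assms] by (intro measure_eqI) (auto simp: emeasure_distr)
qed simp

text \<open>The Borel sets are an intersection-stable generator of themselves, so by
  \<open>indep_vars_finite\<close> the product rule on rectangles is all there is to check.
  \<open>N \<ge> 1\<close> makes the index set non-empty.\<close>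

lemma indep_vars_entry_part:
  assumes \<nu>: "\<nu> > 0" and "N \<ge> 1"
  shows "prob_space.indep_vars (model N M \<nu>) (\<lambda>_. borel) entry_part (entry_indices N M)"
proof -
  interpret prob_space "model N M \<nu>" using \<nu> by (rule prob_space_model)
  let ?K = "entry_indices N M"
  have ne: "?K \<noteq> {}" using assms by auto
  have v: "entry_var \<nu> p > 0" for p using \<nu> by (simp add: entry_var_def)
  have prod: "prob (\<Inter>k\<in>?K. entry_part k -` E k \<inter> space (model N M \<nu>)) =
      (\<Prod>k\<in>?K. prob (entry_part k -` E k \<inter> space (model N M \<nu>)))"
    if E: "E \<in> (\<Pi> k\<in>?K. sets borel)" for E
  proof -
    let ?E = "\<lambda>k. if k \<in> ?K then E k else UNIV"
    have "(\<Inter>k\<in>?K. entry_part k -` E k \<inter> space (model N M \<nu>)) =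
        {\<omega> \<in> space (model N M \<nu>). \<forall>k\<in>?K. entry_part k \<omega> \<in> ?E k}"
      using ne by auto
    moreover have "emeasure (model N M \<nu>) {\<omega> \<in> space (model N M \<nu>). \<forall>k\<in>?K. entry_part k \<omega> \<in> ?E k}
        = (\<Prod>k\<in>?K. emeasure (normal_law (entry_var \<nu> (fst k))) (?E k))"
      using E by (intro emeasure_model_rectangle \<nu>) auto
    moreover have "\<dots> = (\<Prod>k\<in>?K. emeasure (model N M \<nu>) (entry_part k -` E k \<inter> space (model N M \<nu>)))"
      using E emeasure_model_entry_part[OF \<nu>, of _ N M] by (intro prod.cong) (auto simp: Pi_iff)
    ultimately have "emeasure (model N M \<nu>) (\<Inter>k\<in>?K. entry_part k -` E k \<inter> space (model N M \<nu>)) =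
       (\<Prod>k\<in>?K. emeasure (model N M \<nu>) (entry_part k -` E k \<inter> space (model N M \<nu>)))" by simp
    then show ?thesis
      unfolding emeasure_eq_measure by (simp add: prod_ennreal prod_nonneg)
  qed
  have iff: "indep_vars (\<lambda>_. borel) entry_part ?K \<longleftrightarrow>
     (\<forall>E\<in>(\<Pi> k\<in>?K. sets borel). prob (\<Inter>k\<in>?K. entry_part k -` E k \<inter> space (model N M \<nu>)) =
      (\<Prod>k\<in>?K. prob (entry_part k -` E k \<inter> space (model N M \<nu>))))"
  proof (rule indep_vars_finite)
    show "sets (borel :: real measure) = sigma_sets (space borel) (sets borel)"
      by (rule sets.sigma_sets_eq[symmetric])
    show "Int_stable (sets (borel :: real measure))" by (rule sets.Int_stable)
    show "space (borel :: real measure) \<in> sets borel" by (rule sets.top)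
    show "sets (borel :: real measure) \<subseteq> Pow (space borel)" by (rule sets.space_closed)
    show "finite ?K" by simp
  qed (rule ne, erule measurable_entry_part)
  show ?thesis unfolding iff using prod by (rule ballI)
qed

section \<open>The matched filter decoder\<close>

text \<open>The larger key has all predecessors of the smaller one and the smaller one itself, so
  ranks increase strictly. The converse is trichotomy, where \<open>fin\<close> enters.\<close>

lemma rank_less_iff:
  fixes X :: "'i set" and f :: "'i \<Rightarrow> nat \<Rightarrow> real"
  assumes X: "finite X"
    and fin: "\<And>j k. j \<in> X \<Longrightarrow> k \<in> X \<Longrightarrow> finite {t. f j t \<noteq> f k t}"
    and jk: "j \<in> X" "k \<in> X"
  shows "card {i \<in> X. less_fun (f i) (f j)} < card {i \<in> X. less_fun (f i) (f k)} \<longleftrightarrow> less_fun (f j) (f k)"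
proof -
  let ?r = "\<lambda>j. card {i \<in> X. less_fun (f i) (f j)}"
  have mono: "?r j < ?r k" if "j \<in> X" "k \<in> X" "less_fun (f j) (f k)" for j k
  proof (rule psubset_card_mono)
    show "{i \<in> X. less_fun (f i) (f j)} \<subset> {i \<in> X. less_fun (f i) (f k)}"
      using that less_fun_trans less_fun_irrefl by blast
  qed (use X in simp)
  show ?thesis
  proof
    assume lt: "?r j < ?r k"
    then have "f j \<noteq> f k" by auto
    with less_fun_trichotomy[OF fin[OF jk]] mono[OF jk(2,1)] lt
    show "less_fun (f j) (f k)" by auto
  qed (rule mono[OF jk])
qed

text \<open>Distinct keys are totally ordered, so the rank is a bijection from \<open>X\<close> onto
  \<open>{..<card X}\<close>, and exactly \<open>L\<close> elements have a rank below
  \<open>L\<close>.\<close>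

lemma card_lowest_ranks:
  fixes X :: "'i set" and f :: "'i \<Rightarrow> nat \<Rightarrow> real"
  assumes X: "finite X" and inj: "inj_on f X"
    and fin: "\<And>j k. j \<in> X \<Longrightarrow> k \<in> X \<Longrightarrow> finite {t. f j t \<noteq> f k t}"
    and L: "L \<le> card X"
  shows "card {j \<in> X. card {i \<in> X. less_fun (f i) (f j)} < L} = L"
proof -
  let ?r = "\<lambda>j. card {i \<in> X. less_fun (f i) (f j)}"
  have inj_r: "inj_on ?r X"
  proof (rule inj_onI)
    fix j k assume jk: "j \<in> X" "k \<in> X" "?r j = ?r k"
    then have "\<not> less_fun (f j) (f k)" "\<not> less_fun (f k) (f j)"
      using rank_less_iff[where f=f, OF X fin, of j k] rank_less_iff[where f=f, OF X fin, of k j] by simp_all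
    then have "f j = f k" using less_fun_trichotomy[OF fin[OF jk(1,2)]] by blast
    then show "j = k" using inj jk by (auto dest: inj_onD)
  qed
  have "?r j < card X" if "j \<in> X" for j
    by (rule psubset_card_mono) (use X that less_fun_irrefl in auto)
  then have "?r ` X \<subseteq> {..<card X}" by auto
  then have surj: "?r ` X = {..<card X}"
    using card_image[OF inj_r] by (intro card_subset_eq) auto
  have "?r ` {j \<in> X. ?r j < L} = {..<L}"
  proof (intro set_eqI iffI)
    fix l assume l: "l \<in> {..<L}"
    then have "l \<in> ?r ` X" using surj L by auto
    then show "l \<in> ?r ` {j \<in> X. ?r j < L}" using l by auto
  qed auto
  moreover have "inj_on ?r {j \<in> X. ?r j < L}" using inj_r by (rule inj_on_subset) auto
  ultimately show ?thesis using card_image by fastforce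
qed

text \<open>This is \<open>N / 2\<close> times the modulus of the estimator \<open>h_j\<close>: the
  modulus absorbs the conjugation, and the factor is the same for all \<open>j\<close>.\<close>

definition score :: "nat \<Rightarrow> (nat \<Rightarrow> complex) \<Rightarrow> (nat \<times> nat \<Rightarrow> complex) \<Rightarrow> nat \<Rightarrow> real" where
  "score N y A j = cmod (\<Sum>i\<in>{1..N}. A (i, j) * of_real (Re (y i)))"

text \<open>
  Ties in the score are broken by comparing columns lexicographically, which keeps the decoder
  equivariant; the index in the last component only matters for equal columns.
\<close>

definition key :: "nat \<Rightarrow> (nat \<Rightarrow> complex) \<Rightarrow> (nat \<times> nat \<Rightarrow> complex) \<Rightarrow> nat \<Rightarrow> nat \<Rightarrow> real" where
  "key N y A j t =
     (if t = 0 then - score N y A j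
      else if t \<le> N then Re (A (t, j))
      else if t \<le> 2 * N then Im (A (t - N, j))
      else if t = 2 * N + 1 then real j else 0)"

text \<open>Choosing by rank fixes the size at \<open>L\<close> and lets the decoder see the data
  only through comparisons of keys, on which measurability and equivariance can be checked pair by
  pair.\<close>

definition top_decoder ::
  "nat \<Rightarrow> nat \<Rightarrow> nat \<Rightarrow> (nat \<Rightarrow> complex) \<Rightarrow> (nat \<times> nat \<Rightarrow> complex) \<Rightarrow> nat set" where
  "top_decoder M N L y A =
     {j \<in> {1..M}. card {k \<in> {1..M}. less_fun (key N y A k) (key N y A j)} < L}"

lemma finite_key_diff: "finite {t. key N y A j t \<noteq> key N y A k t}"
  by (rule finite_subset[of _ "{..2 * N + 1}"]) (auto simp: key_def)

lemma inj_key: "inj_on (key N y A) X"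
proof (rule inj_onI)
  fix j k assume "key N y A j = key N y A k"
  then have "key N y A j (2 * N + 1) = key N y A k (2 * N + 1)" by simp
  then show "j = k" by (simp add: key_def)
qed

lemma card_top_decoder: "L \<le> M \<Longrightarrow> card (top_decoder M N L y A) = L"
  unfolding top_decoder_def by (rule card_lowest_ranks) (auto intro: inj_key finite_key_diff)

lemma top_decoder_subset: "top_decoder M N L y A \<subseteq> {1..M}"
  by (auto simp: top_decoder_def)

lemma score_top_decoder:
  assumes "j \<in> top_decoder M N L y A" "k \<in> {1..M} - top_decoder M N L y A"
  shows "score N y A k \<le> score N y A j"
proof -
  let ?r = "\<lambda>j. card {i \<in> {1..M}. less_fun (key N y A i) (key N y A j)}"
  have "?r j < ?r k" using assms by (auto simp: top_decoder_def)
  then have "less_fun (key N y A j) (key N y A k)"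
    using assms rank_less_iff[of "{1..M}" "key N y A" j k] by (simp add: finite_key_diff top_decoder_def)
  then obtain t where t: "key N y A j t < key N y A k t" "\<And>t'. t' < t \<Longrightarrow> key N y A j t' = key N y A k t'"
    unfolding less_fun_def by blast
  then have "key N y A j 0 \<le> key N y A k 0" by (cases "t = 0") auto
  then show ?thesis by (simp add: key_def)
qed

text \<open>A lexicographic comparison is decided at the first difference, hence within the first
  \<open>n\<close> positions if a difference occurs there. This hides the last component of
  \<open>key\<close>, which a relabelling does change.\<close>

lemma less_fun_cong_upto:
  fixes f g f' g' :: "nat \<Rightarrow> 'b::linorder"
  assumes eq: "\<And>t. t \<le> n \<Longrightarrow> f t = f' t" "\<And>t. t \<le> n \<Longrightarrow> g t = g' t"
    and diff: "s \<le> n" "f s \<noteq> g s"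
  shows "less_fun f g \<longleftrightarrow> less_fun f' g'"
proof -
  have *: "less_fun a b \<Longrightarrow> less_fun a' b'"
    if "\<And>t. t \<le> n \<Longrightarrow> a t = a' t" "\<And>t. t \<le> n \<Longrightarrow> b t = b' t" "a s \<noteq> b s" for a b a' b' :: "nat \<Rightarrow> 'b"
  proof -
    assume "less_fun a b"
    then obtain t where t: "a t < b t" "\<And>t'. t' < t \<Longrightarrow> a t' = b t'" unfolding less_fun_def by blast
    then have "t \<le> n" using that(3) diff(1) by (meson le_trans not_le)
    then show ?thesis using t that by (intro less_funI exI[of _ t]) auto
  qed
  show ?thesis using *[of f f' g g'] *[of f' f g' g] eq diff by auto
qed

text \<open>Up to position \<open>2 * N\<close> a key depends only on the content of the column,
  which moves along with its label; position \<open>2 * N + 1\<close> holds the label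
  itself.\<close>

lemma key_permute_columns:
  assumes \<pi>: "\<pi> permutes {1..M}" and j: "j \<in> {1..M}" and t: "t \<le> 2 * N"
  shows "key N y (permute_columns N M \<pi> A) (\<pi> j) t = key N y A j t"
proof -
  have "\<pi> j \<in> {1..M}" using permutes_in_image[OF \<pi>] j by simp
  then have col: "permute_columns N M \<pi> A (i, \<pi> j) = A (i, j)" if "i \<in> {1..N}" for i
    using that permutes_inverses[OF \<pi>] by (simp add: permute_columns_def)
  have "score N y (permute_columns N M \<pi> A) (\<pi> j) = score N y A j"
    unfolding score_def using col by (intro arg_cong[where f=cmod] sum.cong) auto
  moreover have "Im (permute_columns N M \<pi> A (t - N, \<pi> j)) = Im (A (t - N, j))" if "\<not> t \<le> N"
  proof -
    have "1 \<le> t - N" "t - N \<le> N" using that t by linarith+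
    then show ?thesis using col[of "t - N"] by simp
  qed
  ultimately show ?thesis using col[of t] t by (auto simp: key_def)
qed

text \<open>Distinct columns differ at some position up to \<open>2 * N\<close>, so no comparison
  reaches the label. Hence \<open>\<pi>\<close> maps the predecessors of \<open>j\<close> onto those
  of \<open>\<pi> j\<close> and preserves ranks.\<close>

lemma top_decoder_equivariant:
  assumes \<pi>: "\<pi> permutes {1..M}" and dist: "distinct_columns N M A"
  shows "top_decoder M N L y (permute_columns N M \<pi> A) = \<pi> ` top_decoder M N L y A"
proof -
  let ?A = "permute_columns N M \<pi> A"
  have less: "less_fun (key N y ?A (\<pi> k)) (key N y ?A (\<pi> j)) \<longleftrightarrow> less_fun (key N y A k) (key N y A j)"
    if jk: "j \<in> {1..M}" "k \<in> {1..M}" for j k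
  proof (cases "j = k")
    case False
    with dist jk obtain i where i: "i \<in> {1..N}" "A (i, k) \<noteq> A (i, j)"
      unfolding distinct_columns_def by metis
    then consider "Re (A (i, k)) \<noteq> Re (A (i, j))" | "Im (A (i, k)) \<noteq> Im (A (i, j))"
      by (auto simp: complex_eq_iff)
    then obtain s where "s \<le> 2 * N" "key N y A k s \<noteq> key N y A j s"
    proof cases
      case 1 then show ?thesis using i that[of i] by (auto simp: key_def)
    next
      case 2 then show ?thesis using i that[of "N + i"] by (auto simp: key_def)
    qed
    then show ?thesis
      using key_permute_columns[OF \<pi>] jk
      by (intro less_fun_cong_upto[of "2 * N", symmetric]) auto
  qed (auto simp: less_fun_irrefl)
  have image: "\<pi> ` {1..M} = {1..M}" using \<pi> by (rule permutes_image)
  have rank: "card {k \<in> {1..M}. less_fun (key N y ?A k) (key N y ?A (\<pi> j))}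
      = card {k \<in> {1..M}. less_fun (key N y A k) (key N y A j)}" if j: "j \<in> {1..M}" for j
  proof -
    have "{k \<in> {1..M}. less_fun (key N y ?A k) (key N y ?A (\<pi> j))}
        = \<pi> ` {k \<in> {1..M}. less_fun (key N y A k) (key N y A j)}"
    proof (intro set_eqI iffI)
      fix l assume l: "l \<in> {k \<in> {1..M}. less_fun (key N y ?A k) (key N y ?A (\<pi> j))}"
      then obtain k where "k \<in> {1..M}" "l = \<pi> k" using image by (metis (no_types, lifting) imageE mem_Collect_eq)
      then show "l \<in> \<pi> ` {k \<in> {1..M}. less_fun (key N y A k) (key N y A j)}" using l less[OF j] by auto
    next
      fix l assume "l \<in> \<pi> ` {k \<in> {1..M}. less_fun (key N y A k) (key N y A j)}"
      then obtain k where k: "k \<in> {1..M}" "less_fun (key N y A k) (key N y A j)" "l = \<pi> k" by auto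
      then show "l \<in> {k \<in> {1..M}. less_fun (key N y ?A k) (key N y ?A (\<pi> j))}"
        using less[OF j k(1)] permutes_in_image[OF \<pi>, of k] by simp
    qed
    then show ?thesis using permutes_inj_on[OF \<pi>] by (simp add: card_image)
  qed
  show ?thesis
  proof (intro set_eqI iffI)
    fix l assume l: "l \<in> top_decoder M N L y ?A"
    then have "l \<in> {1..M}" using top_decoder_subset by blast
    then obtain j where j: "j \<in> {1..M}" "l = \<pi> j" using image by (metis imageE)
    then show "l \<in> \<pi> ` top_decoder M N L y A" using l rank[OF j(1)] by (auto simp: top_decoder_def)
  next
    fix l assume "l \<in> \<pi> ` top_decoder M N L y A"
    then obtain j where j: "j \<in> {1..M}" "j \<in> top_decoder M N L y A" "l = \<pi> j"
      using top_decoder_subset by blast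
    then show "l \<in> top_decoder M N L y ?A"
      using rank[OF j(1)] permutes_in_image[OF \<pi>, of j] by (simp add: top_decoder_def)
  qed
qed

section \<open>Measurability of the decoder, and the energy it misses\<close>

lemma measurable_key:
  assumes j: "j \<in> {1..M}"
  shows "(\<lambda>\<omega>. key N (fst \<omega>) (snd \<omega>) j t) \<in> borel_measurable (vec_space N \<Otimes>\<^sub>M mat_space N M)"
proof -
  have A: "(\<lambda>\<omega>. snd \<omega> (i, j)) \<in> borel_measurable (vec_space N \<Otimes>\<^sub>M mat_space N M)" if "i \<in> {1..N}" for i
  proof -
    have "(i, j) \<in> {1..N} \<times> {1..M}" using that j by simp
    then show ?thesis unfolding mat_space_def by measurable
  qed
  have y: "(\<lambda>\<omega>. fst \<omega> i) \<in> borel_measurable (vec_space N \<Otimes>\<^sub>M mat_space N M)" if "i \<in> {1..N}" for i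
    using that unfolding vec_space_def by measurable
  have score: "(\<lambda>\<omega>. score N (fst \<omega>) (snd \<omega>) j) \<in> borel_measurable (vec_space N \<Otimes>\<^sub>M mat_space N M)"
    unfolding score_def
    by (intro measurable_compose[OF _ borel_measurable_norm] borel_measurable_sum borel_measurable_times
      measurable_compose[OF _ borel_measurable_of_real] measurable_compose[OF y borel_measurable_Re] A) auto
  consider "t = 0" | "t \<in> {1..N}" | "t - N \<in> {1..N}" "t \<le> 2 * N" | "t > 2 * N" by force
  then show ?thesis
  proof cases
    case 1 then show ?thesis using score by (simp add: key_def)
  next
    case 2 then show ?thesis using measurable_compose[OF A[OF 2] borel_measurable_Re] by (simp add: key_def)
  next
    case 3
    then have "\<not> t \<le> N" by auto
    then have "key N (fst \<omega>) (snd \<omega>) j t = Im (snd \<omega> (t - N, j))" for \<omega> using 3 by (simp add: key_def)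
    then show ?thesis using measurable_compose[OF A[OF 3(1)] borel_measurable_Im] by simp
  next
    case 4 then show ?thesis by (simp add: key_def)
  qed
qed

text \<open>Only the finitely many subsets of \<open>{1..M}\<close> occur as values, so it suffices
  to treat preimages of singletons; these are finite conjunctions of membership conditions.\<close>

lemma measurable_top_decoder:
  "(\<lambda>(y, A). top_decoder M N L y A) \<in> measurable (vec_space N \<Otimes>\<^sub>M mat_space N M) (count_space UNIV)"
proof -
  let ?W = "vec_space N \<Otimes>\<^sub>M mat_space N M"
  let ?D = "\<lambda>\<omega>. top_decoder M N L (fst \<omega>) (snd \<omega>)"
  let ?less = "\<lambda>\<omega> k j. less_fun (key N (fst \<omega>) (snd \<omega>) k) (key N (fst \<omega>) (snd \<omega>) j)"
  have less [measurable]: "Measurable.pred ?W (\<lambda>\<omega>. ?less \<omega> k j)" if "k \<in> {1..M}" "j \<in> {1..M}" for k j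
    unfolding less_fun_def using measurable_key[OF that(1)] measurable_key[OF that(2)] by measurable
  have mem: "Measurable.pred ?W (\<lambda>\<omega>. j \<in> ?D \<omega>)" if "j \<in> {1..M}" for j
  proof -
    \<comment> \<open>The rank is written as a sum of indicators, which is visibly a measurable
      function.\<close>
    have "j \<in> ?D \<omega> \<longleftrightarrow> (\<Sum>k\<in>{1..M}. if ?less \<omega> k j then 1 else 0 :: real) < real L" for \<omega>
      using that by (simp add: top_decoder_def sum.If_cases Int_def)
    moreover have "(\<lambda>\<omega>. \<Sum>k\<in>{1..M}. if ?less \<omega> k j then 1 else 0 :: real) \<in> borel_measurable ?W"
      using less[OF _ that] by (intro borel_measurable_sum measurable_If) auto
    ultimately show ?thesis by simp
  qed
  have "?D \<in> measurable ?W (count_space (Pow {1..M}))"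
  proof (subst measurable_count_space_eq2, simp, intro conjI ballI)
    fix S assume "S \<in> Pow {1..M}"
    then have "?D -` {S} \<inter> space ?W = {\<omega> \<in> space ?W. \<forall>j\<in>{1..M}. j \<in> ?D \<omega> \<longleftrightarrow> j \<in> S}"
      using top_decoder_subset[of M N L] by blast
    moreover have "Measurable.pred ?W (\<lambda>\<omega>. \<forall>j\<in>{1..M}. j \<in> ?D \<omega> \<longleftrightarrow> j \<in> S)"
      using mem by measurable
    ultimately show "?D -` {S} \<inter> space ?W \<in> sets ?W" by (simp add: pred_def)
  qed (use top_decoder_subset in auto)
  then have "?D \<in> measurable ?W (count_space UNIV)"
    by (rule measurable_compose[where g="\<lambda>S. S"]) simp
  then show ?thesis by (simp add: case_prod_beta')
qed

lemma is_decoder_top_decoder: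
  assumes "L \<le> M" shows "is_decoder M N L (top_decoder M N L)"
  unfolding is_decoder_def
proof (intro conjI ballI allI impI)
  fix y A \<pi> assume "\<pi> permutes {1..M}" "distinct_columns N M A"
  then show "top_decoder M N L y (permute_columns N M \<pi> A) = \<pi> ` top_decoder M N L y A"
    by (rule top_decoder_equivariant)
qed (rule measurable_top_decoder top_decoder_subset card_top_decoder[OF assms])+

text \<open>Let a bijection \<open>f\<close> send each missed \<open>k\<close> to a wrongly chosen
  \<open>f k\<close>. There \<open>x\<close> vanishes, so \<open>cmod (h k)\<close> is at most the
  error at \<open>f k\<close>, and \<open>cmod (x k)\<close> is at most the sum of the errors at
  \<open>k\<close> and \<open>f k\<close>. The two index sets are disjoint, so each error is counted
  once; the factor 2 comes from squaring the sum.\<close>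

lemma energy_outside_top_le:
  fixes x h :: "'i \<Rightarrow> complex"
  assumes X: "finite X" and sub: "S \<subseteq> X" "I \<subseteq> X" and card: "card S = card I"
    and zero: "\<And>j. j \<in> X - I \<Longrightarrow> x j = 0"
    and top: "\<And>j k. j \<in> S \<Longrightarrow> k \<in> X - S \<Longrightarrow> cmod (h k) \<le> cmod (h j)"
  shows "(\<Sum>k\<in>I - S. (cmod (x k))\<^sup>2) \<le> 2 * (\<Sum>j\<in>X. (cmod (h j - x j))\<^sup>2)"
proof -
  let ?e = "\<lambda>j. (cmod (h j - x j))\<^sup>2"
  have fin: "finite S" "finite I" using X sub finite_subset by auto
  have "card (I - S) = card (S - I)"
    using fin card by (simp add: card_Diff_subset_Int Int_commute)
  then obtain f where f: "bij_betw f (I - S) (S - I)"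
    using fin by (meson finite_Diff finite_same_card_bij)
  have "(cmod (x k))\<^sup>2 \<le> 2 * ?e k + 2 * ?e (f k)" if k: "k \<in> I - S" for k
  proof -
    have fk: "f k \<in> S - I" using f k by (auto simp: bij_betw_def)
    have "cmod (x k) \<le> cmod (h k - x k) + cmod (h k)"
      using norm_triangle_ineq4[of "h k" "h k - x k"] by simp
    also have "cmod (h k) \<le> cmod (h (f k) - x (f k))"
      using top[of "f k" k] fk k sub zero[of "f k"] by (auto simp: subset_iff)
    finally have "(cmod (x k))\<^sup>2 \<le> (cmod (h k - x k) + cmod (h (f k) - x (f k)))\<^sup>2"
      by (intro power_mono) auto
    also have "\<dots> \<le> 2 * ?e k + 2 * ?e (f k)"
      using zero_le_power2[of "cmod (h k - x k) - cmod (h (f k) - x (f k))"]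
      by (simp add: power2_eq_square algebra_simps)
    finally show ?thesis .
  qed
  then have "(\<Sum>k\<in>I - S. (cmod (x k))\<^sup>2) \<le> (\<Sum>k\<in>I - S. 2 * ?e k + 2 * ?e (f k))" by (rule sum_mono)
  also have "\<dots> = 2 * ((\<Sum>k\<in>I - S. ?e k) + (\<Sum>k\<in>S - I. ?e k))"
    using sum.reindex_bij_betw[OF f, of ?e] by (simp add: sum.distrib flip: sum_distrib_left)
  also have "(\<Sum>k\<in>I - S. ?e k) + (\<Sum>k\<in>S - I. ?e k) = (\<Sum>k\<in>(I - S) \<union> (S - I). ?e k)"
    using fin by (intro sum.union_disjoint[symmetric]) auto
  also have "\<dots> \<le> (\<Sum>j\<in>X. ?e j)" using X sub by (intro sum_mono2) auto
  finally show ?thesis by simp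
qed

section \<open>The probability of error\<close>

lemma (in prob_space) indep_vars_reindex:
  assumes "indep_vars M' X I" and "inj_on f L" and "f ` L \<subseteq> I"
  shows "indep_vars (\<lambda>l. M' (f l)) (\<lambda>l. X (f l)) L"
proof -
  have "indep_vars (\<lambda>l. PiM {f l} M') (\<lambda>l \<omega>. restrict (\<lambda>i. X i \<omega>) {f l}) L"
    using assms by (intro indep_vars_restrict[OF assms(1)]) (auto simp: disjoint_family_on_def inj_on_def)
  then have "indep_vars (\<lambda>l. M' (f l)) (\<lambda>l \<omega>. (restrict (\<lambda>i. X i \<omega>) {f l}) (f l)) L"
    by (rule indep_vars_compose2) (rule measurable_component_singleton, simp)
  then show ?thesis by simp
qed

text \<open>Markov's inequality for \<open>T\<^sup>2\<close>, stated with the nonnegative integral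
  that the moment estimates deliver.\<close>

lemma (in prob_space) prob_ge_le_second_moment:
  assumes T [measurable]: "T \<in> borel_measurable M" and a: "(a::real) > 0" and C: "0 \<le> C"
    and le: "(\<integral>\<^sup>+\<omega>. ennreal ((T \<omega>)\<^sup>2) \<partial>M) \<le> ennreal C"
  shows "prob {\<omega> \<in> space M. a \<le> T \<omega>} \<le> C / a\<^sup>2"
proof -
  have sub: "{\<omega> \<in> space M. a \<le> T \<omega>} \<subseteq> {\<omega> \<in> space M. 1 \<le> ennreal (1 / a\<^sup>2) * ennreal ((T \<omega>)\<^sup>2)}"
  proof safe
    fix \<omega> assume "a \<le> T \<omega>"
    then have "a\<^sup>2 \<le> (T \<omega>)\<^sup>2" using a by (intro power_mono) auto
    then have "1 \<le> 1 / a\<^sup>2 * (T \<omega>)\<^sup>2" using a by (simp add: field_simps)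
    then show "1 \<le> ennreal (1 / a\<^sup>2) * ennreal ((T \<omega>)\<^sup>2)"
      by (subst ennreal_mult[symmetric]) (auto simp: ennreal_ge_1)
  qed
  have "emeasure M {\<omega> \<in> space M. a \<le> T \<omega>} \<le> emeasure M {\<omega> \<in> space M. 1 \<le> ennreal (1 / a\<^sup>2) * ennreal ((T \<omega>)\<^sup>2)}"
    by (intro emeasure_mono sub) measurable
  also have "\<dots> \<le> ennreal (1 / a\<^sup>2) * (\<integral>\<^sup>+\<omega>. ennreal ((T \<omega>)\<^sup>2) * indicator (space M) \<omega> \<partial>M)"
    by (rule nn_integral_Markov_inequality) auto
  also have "(\<integral>\<^sup>+\<omega>. ennreal ((T \<omega>)\<^sup>2) * indicator (space M) \<omega> \<partial>M) = (\<integral>\<^sup>+\<omega>. ennreal ((T \<omega>)\<^sup>2) \<partial>M)"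
    by (intro nn_integral_cong) simp
  also have "ennreal (1 / a\<^sup>2) * \<dots> \<le> ennreal (1 / a\<^sup>2) * ennreal C" by (intro mult_left_mono le) simp
  also have "\<dots> = ennreal (C / a\<^sup>2)" using C by (simp flip: ennreal_mult)
  finally show ?thesis unfolding emeasure_eq_measure using C by (simp add: ennreal_le_iff)
qed

text \<open>The sign of the imaginary parts makes \<open>Re (A i j * x j)\<close> a sum of products with plus signs.\<close>

definition std_entry :: "real \<Rightarrow> (nat \<times> nat) \<times> bool \<Rightarrow> (nat \<times> nat \<Rightarrow> complex) \<times> (nat \<Rightarrow> complex) \<Rightarrow> real" where
  "std_entry \<nu> k \<omega> = (if snd k then 1 else - 1) * sqrt (2 / entry_var \<nu> (fst k)) * entry_part k \<omega>"

text \<open>The coefficients of \<open>sqrt 2 * Re (y i)\<close> in the standardised entries of row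
  \<open>i\<close>. Column 0 contributes \<open>\<nu>\<close> through the real part of the noise;
  the imaginary part does not enter \<open>Re (y i)\<close>.\<close>

definition weight :: "real \<Rightarrow> (nat \<Rightarrow> complex) \<Rightarrow> nat \<times> bool \<Rightarrow> real" where
  "weight \<nu> x q = (if fst q = 0 then if snd q then \<nu> else 0
     else if snd q then Re (x (fst q)) else Im (x (fst q)))"

definition row_obs :: "nat \<Rightarrow> real \<Rightarrow> (nat \<Rightarrow> complex) \<Rightarrow> nat \<Rightarrow> (nat \<times> nat \<Rightarrow> complex) \<times> (nat \<Rightarrow> complex) \<Rightarrow> real" where
  "row_obs M \<nu> x i \<omega> = (\<Sum>q\<in>{0..M} \<times> UNIV. weight \<nu> x q * std_entry \<nu> ((i, fst q), snd q) \<omega>)"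

text \<open>Summed over the rows, the residuals at \<open>(j, True)\<close> and
  \<open>(j, False)\<close> are \<open>N\<close> times the real and imaginary part of
  \<open>h_j - x_j\<close>.\<close>

definition residual ::
  "nat \<Rightarrow> real \<Rightarrow> (nat \<Rightarrow> complex) \<Rightarrow> nat \<Rightarrow> nat \<times> bool \<Rightarrow> (nat \<times> nat \<Rightarrow> complex) \<times> (nat \<Rightarrow> complex) \<Rightarrow> real" where
  "residual M \<nu> x i q \<omega> = std_entry \<nu> ((i, fst q), snd q) \<omega> * row_obs M \<nu> x i \<omega> - weight \<nu> x q"

lemma sum_prod_bool: "(\<Sum>q\<in>S \<times> UNIV. f q) = (\<Sum>j\<in>S. f (j, True) + f (j, False))"
  for f :: "nat \<times> bool \<Rightarrow> real"
  unfolding sum.cartesian_product' UNIV_bool by (simp add: add.commute)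

lemma sum_prod_bool_0:
  "(\<Sum>q\<in>{0..M} \<times> UNIV. f q) = f (0, True) + f (0, False) + (\<Sum>j\<in>{1..M}. f (j, True) + f (j, False))"
  for f :: "nat \<times> bool \<Rightarrow> real"
  unfolding sum_prod_bool by (subst sum.atLeast_Suc_atMost) simp_all

lemma sum_weight: "(\<Sum>q\<in>{0..M} \<times> UNIV. (weight \<nu> x q)\<^sup>2) = \<nu>\<^sup>2 + energy M x"
proof -
  have "(\<Sum>j\<in>{1..M}. (weight \<nu> x (j, True))\<^sup>2 + (weight \<nu> x (j, False))\<^sup>2) = energy M x"
    unfolding energy_def by (intro sum.cong) (auto simp: weight_def cmod_power2)
  then show ?thesis unfolding sum_prod_bool_0 by (simp add: weight_def)
qed

lemma row_obs_eq:
  assumes \<nu>: "\<nu> > 0" and i: "i \<in> {1..N}"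
  shows "row_obs M \<nu> x i (A, n) = sqrt 2 * Re (observation N M x A n i)"
proof -
  let ?t = "\<lambda>q. weight \<nu> x q * std_entry \<nu> ((i, fst q), snd q) (A, n)"
  have "?t (0, True) + ?t (0, False) = sqrt 2 * Re (n i)"
    using \<nu> by (simp add: weight_def std_entry_def entry_part_def entry_def entry_var_def real_sqrt_divide)
  moreover have "(\<Sum>j\<in>{1..M}. ?t (j, True) + ?t (j, False)) = (\<Sum>j\<in>{1..M}. sqrt 2 * Re (A (i, j) * x j))"
    by (intro sum.cong) (auto simp: weight_def std_entry_def entry_part_def entry_def entry_var_def algebra_simps)
  ultimately have "row_obs M \<nu> x i (A, n) = sqrt 2 * Re (n i) + (\<Sum>j\<in>{1..M}. sqrt 2 * Re (A (i, j) * x j))"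
    unfolding row_obs_def sum_prod_bool_0 by (simp only:)
  also have "\<dots> = sqrt 2 * Re (observation N M x A n i)"
    using i by (simp add: observation_def distrib_left sum_distrib_left)
  finally show ?thesis .
qed

lemma std_entry_model:
  assumes \<nu>: "\<nu> > 0" and N: "N \<ge> 1"
  shows "k \<in> entry_indices N M \<Longrightarrow> distributed (model N M \<nu>) lborel (std_entry \<nu> k) std_normal_density"
    and "prob_space.indep_vars (model N M \<nu>) (\<lambda>_. borel) (std_entry \<nu>) (entry_indices N M)"
proof -
  interpret prob_space "model N M \<nu>" using \<nu> by (rule prob_space_model)
  have v: "entry_var \<nu> p > 0" for p using \<nu> by (simp add: entry_var_def)
  show "distributed (model N M \<nu>) lborel (std_entry \<nu> k) std_normal_density" if "k \<in> entry_indices N M"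
  proof -
    let ?a = "(if snd k then 1 else - 1) * sqrt (2 / entry_var \<nu> (fst k))"
    have "\<bar>?a\<bar> * sqrt (entry_var \<nu> (fst k) / 2) = 1"
      using v[of "fst k"] by (simp add: abs_mult flip: real_sqrt_mult)
    moreover have "distributed (model N M \<nu>) lborel (\<lambda>\<omega>. 0 + ?a * entry_part k \<omega>)
       (normal_density (0 + ?a * 0) (\<bar>?a\<bar> * sqrt (entry_var \<nu> (fst k) / 2)))"
      using v[of "fst k"] by (intro normal_density_affine distributed_entry_part \<nu> that) auto
    ultimately show ?thesis by (simp add: std_entry_def[abs_def])
  qed
  show "indep_vars (\<lambda>_. borel) (std_entry \<nu>) (entry_indices N M)"
    unfolding std_entry_def[abs_def]
    by (rule indep_vars_compose2[OF indep_vars_entry_part[OF \<nu> N]]) measurable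
qed

lemma second_moment_residual:
  fixes x :: "nat \<Rightarrow> complex" and M N :: nat
  assumes \<nu>: "\<nu> > 0" and N: "N \<ge> 1"
  defines "V \<equiv> \<nu>\<^sup>2 + energy M x"
  defines "\<kappa> \<equiv> 3 * (1 + V\<^sup>2) / 2" and "K \<equiv> 420 * (1 + V ^ 4) + 8 * V\<^sup>2"
  obtains m where "m \<le> real N * (2 * real M * \<kappa>)"
    "(\<integral>\<^sup>+\<omega>. ennreal (((\<Sum>q\<in>{1..M} \<times> UNIV. (\<Sum>i\<in>{1..N}. residual M \<nu> x i q \<omega>)\<^sup>2) - m)\<^sup>2) \<partial>model N M \<nu>)
      \<le> ennreal (8 * \<kappa> * (2 * real M * \<kappa>) * (real N)\<^sup>2 + 2 * ((2 * real M)\<^sup>2 * K) * real N)"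
proof -
  interpret prob_space "model N M \<nu>" using \<nu> by (rule prob_space_model)
  \<comment> \<open>\<open>?J\<close> leaves out column 0: the noise enters the observation of every
    row but is not estimated.\<close>
  let ?H = "{0..M} \<times> (UNIV :: bool set)" and ?J = "{1..M} \<times> (UNIV :: bool set)"
  let ?g = "\<lambda>i q. std_entry \<nu> ((i, fst q), snd q)"
  have ind: "indep_vars (\<lambda>_. borel) (?g i) ?H" if "i \<in> {1..N}" for i
    using that by (intro indep_vars_reindex[OF std_entry_model(2)[OF \<nu> N]]) (auto simp: inj_on_def)
  have dist: "distributed (model N M \<nu>) lborel (?g i q) std_normal_density" if "i \<in> {1..N}" "q \<in> ?H" for i q
    using that by (intro std_entry_model(1)[OF \<nu> N]) auto
  have JH: "?J \<subseteq> ?H" by auto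
  have cardJ: "real (card ?J) = 2 * real M" by (simp add: card_cartesian_product)
  note mom = centred_row_moments[where K="?H" and J="?J" and w="weight \<nu> x", OF _ ind dist JH,
      unfolded sum_weight, folded row_obs_def residual_def V_def, folded \<kappa>_def K_def, unfolded cardJ]
  let ?R = "\<lambda>i. ({i} \<times> {0..M}) \<times> (UNIV :: bool set)"
  \<comment> \<open>The residuals of row \<open>i\<close> as a function of the entries of that row
    alone. The blocks \<open>?R i\<close> are disjoint, so independence passes from the entries to
    the rows.\<close>
  let ?f = "\<lambda>i r. \<lambda>q\<in>?J. r ((i, fst q), snd q) * (\<Sum>q\<in>?H. weight \<nu> x q * r ((i, fst q), snd q)) - weight \<nu> x q"
  have "indep_vars (\<lambda>i. PiM (?R i) (\<lambda>_. borel)) (\<lambda>i \<omega>. restrict (\<lambda>k. std_entry \<nu> k \<omega>) (?R i)) {1..N}"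
    by (rule indep_vars_restrict[OF std_entry_model(2)[OF \<nu> N]]) (auto simp: disjoint_family_on_def)
  moreover have "?f i \<in> PiM (?R i) (\<lambda>_. borel) \<rightarrow>\<^sub>M PiM ?J (\<lambda>_. borel)" for i
  proof -
    have "(\<lambda>r. r ((i, fst q), snd q)) \<in> borel_measurable (PiM (?R i) (\<lambda>_. borel :: real measure))" if "q \<in> ?H" for q
      using that by (intro measurable_component_singleton) auto
    then show ?thesis using JH
      by (intro measurable_restrict borel_measurable_diff borel_measurable_times borel_measurable_sum borel_measurable_const) auto
  qed
  ultimately have "indep_vars (\<lambda>_. PiM ?J (\<lambda>_. borel)) (\<lambda>i \<omega>. ?f i (restrict (\<lambda>k. std_entry \<nu> k \<omega>) (?R i))) {1..N}"
    by (rule indep_vars_compose2)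
  moreover have "?f i (restrict (\<lambda>k. std_entry \<nu> k \<omega>) (?R i)) = (\<lambda>q\<in>?J. residual M \<nu> x i q \<omega>)" for i \<omega>
    using JH by (intro restrict_ext) (auto simp: residual_def row_obs_def intro!: sum.cong)
  ultimately have rows: "indep_vars (\<lambda>_. PiM ?J (\<lambda>_. borel)) (\<lambda>i \<omega>. \<lambda>q\<in>?J. residual M \<nu> x i q \<omega>) {1..N}"
    by (simp only:)
  let ?m = "\<lambda>i. expectation (\<lambda>\<omega>. \<Sum>q\<in>?J. (residual M \<nu> x i q \<omega>)\<^sup>2)"
  show thesis
  proof (rule that)
    have "(\<Sum>i\<in>{1..N}. ?m i) \<le> (\<Sum>i\<in>{1..N}. 2 * real M * \<kappa>)"
      by (intro sum_mono mom(3)) auto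
    then show "(\<Sum>i\<in>{1..N}. ?m i) \<le> real N * (2 * real M * \<kappa>)" by simp
    have "(\<integral>\<^sup>+\<omega>. ennreal (((\<Sum>q\<in>?J. (\<Sum>i\<in>{1..N}. residual M \<nu> x i q \<omega>)\<^sup>2) - (\<Sum>i\<in>{1..N}. ?m i))\<^sup>2) \<partial>model N M \<nu>)
      \<le> ennreal (8 * \<kappa> * (2 * real M * \<kappa>) * (real (card {1..N}))\<^sup>2 + 2 * ((2 * real M)\<^sup>2 * K) * real (card {1..N}))"
    proof (rule second_moment_squared_norm_indep[OF rows])
      fix i assume i: "i \<in> {1..N}"
      show "integrable (model N M \<nu>) (\<lambda>\<omega>. (\<Sum>q\<in>?J. (residual M \<nu> x i q \<omega>)\<^sup>2)\<^sup>2)"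
        using i by (intro mom(4)) auto
      show "expectation (\<lambda>\<omega>. (\<Sum>q\<in>?J. (residual M \<nu> x i q \<omega>)\<^sup>2)\<^sup>2) \<le> (2 * real M)\<^sup>2 * K"
        using i by (intro mom(5)) auto
      show "?m i \<le> 2 * real M * \<kappa>"
        using i by (intro mom(3)) auto
      show "expectation (residual M \<nu> x i q) = 0" if "q \<in> ?J" for q
        using i that by (intro mom(1)) auto
      show "expectation (\<lambda>\<omega>. (\<Sum>q\<in>?J. u q * residual M \<nu> x i q \<omega>)\<^sup>2) \<le> \<kappa> * (\<Sum>q\<in>?J. (u q)\<^sup>2)" for u
        using i by (intro mom(2)) auto
    qed (use N \<kappa>_def in auto)
    then show "(\<integral>\<^sup>+\<omega>. ennreal (((\<Sum>q\<in>?J. (\<Sum>i\<in>{1..N}. residual M \<nu> x i q \<omega>)\<^sup>2) - (\<Sum>i\<in>{1..N}. ?m i))\<^sup>2) \<partial>model N M \<nu>)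
      \<le> ennreal (8 * \<kappa> * (2 * real M * \<kappa>) * (real N)\<^sup>2 + 2 * ((2 * real M)\<^sup>2 * K) * real N)" by simp
  qed
qed

text \<open>The factor \<open>(real N)\<^sup>2\<close> is there because the residuals are summed,
  not averaged: the event says that the squared norm of \<open>h - x\<close> is at least
  \<open>\<delta>\<close>.\<close>

definition large_error :: "nat \<Rightarrow> nat \<Rightarrow> real \<Rightarrow> (nat \<Rightarrow> complex) \<Rightarrow> real \<Rightarrow> ((nat \<times> nat \<Rightarrow> complex) \<times> (nat \<Rightarrow> complex)) set" where
  "large_error N M \<nu> x \<delta> = {\<omega> \<in> space (model N M \<nu>).
     \<delta> * (real N)\<^sup>2 \<le> (\<Sum>q\<in>{1..M} \<times> UNIV. (\<Sum>i\<in>{1..N}. residual M \<nu> x i q \<omega>)\<^sup>2)}"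

lemma measurable_norm_residual:
  assumes \<nu>: "\<nu> > 0" and N: "N \<ge> 1"
  shows "(\<lambda>\<omega>. \<Sum>q\<in>{1..M} \<times> UNIV. (\<Sum>i\<in>{1..N}. residual M \<nu> x i q \<omega>)\<^sup>2) \<in> borel_measurable (model N M \<nu>)"
proof -
  have std: "std_entry \<nu> k \<in> borel_measurable (model N M \<nu>)" if "k \<in> entry_indices N M" for k
    using measurable_entry_part[OF that, of \<nu>] unfolding std_entry_def[abs_def] by measurable
  show ?thesis
    unfolding residual_def row_obs_def
    by (intro borel_measurable_sum borel_measurable_power borel_measurable_diff borel_measurable_times borel_measurable_const std) auto
qed

text \<open>By \<open>ratio\<close> the mean is at most half the threshold, so a large error is a
  deviation of at least \<open>\<delta> * N\<^sup>2 / 2\<close>. By \<open>M \<le> N\<close> the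
  second moment is of order N^3, and Chebyshev leaves N^3 / N^4.\<close>

lemma prob_large_error:
  fixes x :: "nat \<Rightarrow> complex" and M N :: nat
  assumes \<nu>: "\<nu> > 0" and N: "N \<ge> 1" and MN: "M \<le> N" and \<delta>: "\<delta> > 0"
  defines "V \<equiv> \<nu>\<^sup>2 + energy M x"
  defines "\<kappa> \<equiv> 3 * (1 + V\<^sup>2) / 2" and "K \<equiv> 420 * (1 + V ^ 4) + 8 * V\<^sup>2"
  assumes ratio: "4 * real M * \<kappa> \<le> real N * \<delta>"
  shows "measure (model N M \<nu>) (large_error N M \<nu> x \<delta>) \<le> 4 * (16 * \<kappa>\<^sup>2 + 8 * K) / (\<delta>\<^sup>2 * real N)"
proof -
  interpret prob_space "model N M \<nu>" using \<nu> by (rule prob_space_model)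
  let ?Q = "\<lambda>\<omega>. \<Sum>q\<in>{1..M} \<times> UNIV. (\<Sum>i\<in>{1..N}. residual M \<nu> x i q \<omega>)\<^sup>2"
  obtain m where m: "m \<le> real N * (2 * real M * \<kappa>)"
    and mom: "(\<integral>\<^sup>+\<omega>. ennreal ((?Q \<omega> - m)\<^sup>2) \<partial>model N M \<nu>)
      \<le> ennreal (8 * \<kappa> * (2 * real M * \<kappa>) * (real N)\<^sup>2 + 2 * ((2 * real M)\<^sup>2 * K) * real N)"
    using second_moment_residual[OF \<nu> N, of M x] unfolding V_def \<kappa>_def K_def by blast
  have \<kappa>: "\<kappa> \<ge> 0" and K: "K \<ge> 0" unfolding \<kappa>_def K_def by (auto intro!: add_nonneg_nonneg)
  have N0: "real N > 0" using N by simp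
  let ?a = "\<delta> * (real N)\<^sup>2 / 2" and ?C = "(16 * \<kappa>\<^sup>2 + 8 * K) * real N ^ 3"
  have "8 * \<kappa> * (2 * real M * \<kappa>) * (real N)\<^sup>2 + 2 * ((2 * real M)\<^sup>2 * K) * real N
      = 16 * \<kappa>\<^sup>2 * (real M * (real N)\<^sup>2) + 8 * K * ((real M)\<^sup>2 * real N)"
    by (simp add: power2_eq_square)
  also have "\<dots> \<le> 16 * \<kappa>\<^sup>2 * (real N * (real N)\<^sup>2) + 8 * K * ((real N)\<^sup>2 * real N)"
    using MN K by (intro add_mono mult_left_mono mult_right_mono power_mono) auto
  also have "\<dots> = ?C" by (simp add: power2_eq_square power3_eq_cube algebra_simps)
  finally have mom': "(\<integral>\<^sup>+\<omega>. ennreal ((?Q \<omega> - m)\<^sup>2) \<partial>model N M \<nu>) \<le> ennreal ?C"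
    using mom order_trans ennreal_leI by blast
  have "m \<le> ?a"
  proof -
    have "real N * (4 * real M * \<kappa>) \<le> real N * (real N * \<delta>)" by (intro mult_left_mono ratio) simp
    then show ?thesis using m by (simp add: power2_eq_square algebra_simps)
  qed
  then have "large_error N M \<nu> x \<delta> \<subseteq> {\<omega> \<in> space (model N M \<nu>). ?a \<le> ?Q \<omega> - m}"
    by (auto simp: large_error_def)
  then have "prob (large_error N M \<nu> x \<delta>) \<le> prob {\<omega> \<in> space (model N M \<nu>). ?a \<le> ?Q \<omega> - m}"
    using measurable_norm_residual[OF \<nu> N, of M x]
    by (intro finite_measure_mono borel_measurable_le borel_measurable_const borel_measurable_diff)
  also have "\<dots> \<le> ?C / ?a\<^sup>2"
    using measurable_norm_residual[OF \<nu> N, of M x] \<delta> N0 K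
    by (intro prob_ge_le_second_moment mom' borel_measurable_diff) auto
  also have "\<dots> = 4 * (16 * \<kappa>\<^sup>2 + 8 * K) / (\<delta>\<^sup>2 * real N)"
    using \<delta> N0 by (simp add: field_simps power2_eq_square power3_eq_cube)
  finally show ?thesis .
qed

text \<open>A failure leaves at least the energy \<open>\<gamma> * energy M x\<close> on the missed
  indices; the factor 2 of \<open>energy_outside_top_le\<close> halves it to the threshold.\<close>

lemma failure_subset_large_error:
  assumes \<nu>: "\<nu> > 0" and N: "N \<ge> 1" and card: "card (support M x) = L"
    and \<omega>: "(A, n) \<in> space (model N M \<nu>)"
    and fail: "\<not> success3 \<gamma> M x (top_decoder M N L (observation N M x A n) A)"
  shows "(A, n) \<in> large_error N M \<nu> x (\<gamma> * energy M x / 2)"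
proof -
  define y where "y = observation N M x A n"
  \<comment> \<open>Each summand has mean \<open>cnj (x j) / 2\<close>, which explains
    \<open>2 / N\<close>; as \<open>Re (y i)\<close> is real, one conjugation outside the sum is
    enough.\<close>
  define h where "h j = of_real (2 / real N) * cnj (\<Sum>i\<in>{1..N}. A (i, j) * of_real (Re (y i)))" for j
  let ?S = "top_decoder M N L y A" and ?I = "support M x"
  have N0: "real N > 0" using N by simp
  have I: "?I \<subseteq> {1..M}" by (auto simp: support_def)
  then have "L \<le> M" using card card_mono[of "{1..M}" ?I] by simp
  then have cardS: "card ?S = L" by (rule card_top_decoder)
  have cmod_h: "cmod (h j) = 2 / real N * score N y A j" for j
    unfolding h_def score_def by (simp only: norm_mult norm_of_real complex_mod_cnj) simp
  have out: "(\<Sum>k\<in>?I - ?S. (cmod (x k))\<^sup>2) \<le> 2 * (\<Sum>j\<in>{1..M}. (cmod (h j - x j))\<^sup>2)"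
  proof (rule energy_outside_top_le)
    show "cmod (h k) \<le> cmod (h j)" if "j \<in> ?S" "k \<in> {1..M} - ?S" for j k
      unfolding cmod_h using score_top_decoder[OF that] by (intro mult_left_mono) auto
  qed (use I cardS card top_decoder_subset in \<open>auto simp: support_def\<close>)
  have err: "(real N)\<^sup>2 * (cmod (h j - x j))\<^sup>2 =
      (\<Sum>i\<in>{1..N}. residual M \<nu> x i (j, True) (A, n))\<^sup>2 + (\<Sum>i\<in>{1..N}. residual M \<nu> x i (j, False) (A, n))\<^sup>2"
    if j: "j \<in> {1..M}" for j
  proof -
    have res: "residual M \<nu> x i (j, True) (A, n) = 2 * (Re (A (i, j)) * Re (y i)) - Re (x j)"
      "residual M \<nu> x i (j, False) (A, n) = - (2 * (Im (A (i, j)) * Re (y i))) - Im (x j)" if "i \<in> {1..N}" for i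
      using j row_obs_eq[OF \<nu> that, of M x A n]
      by (auto simp: residual_def weight_def std_entry_def entry_part_def entry_def entry_var_def y_def algebra_simps)
    have "(\<Sum>i\<in>{1..N}. residual M \<nu> x i (j, True) (A, n)) = (\<Sum>i\<in>{1..N}. 2 * (Re (A (i, j)) * Re (y i)) - Re (x j))"
      by (intro sum.cong refl res)
    also have "\<dots> = real N * Re (h j - x j)"
      using N0 by (simp add: h_def right_diff_distrib sum_subtractf sum_distrib_left)
    finally have re: "(\<Sum>i\<in>{1..N}. residual M \<nu> x i (j, True) (A, n)) = real N * Re (h j - x j)" .
    have "(\<Sum>i\<in>{1..N}. residual M \<nu> x i (j, False) (A, n)) = (\<Sum>i\<in>{1..N}. - (2 * (Im (A (i, j)) * Re (y i))) - Im (x j))"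
      by (intro sum.cong refl res)
    also have "\<dots> = real N * Im (h j - x j)"
      using N0 by (simp add: h_def right_diff_distrib sum_subtractf sum_distrib_left sum_negf)
    finally have im: "(\<Sum>i\<in>{1..N}. residual M \<nu> x i (j, False) (A, n)) = real N * Im (h j - x j)" .
    show ?thesis unfolding re im by (simp add: cmod_power2 distrib_left power_mult_distrib)
  qed
  have "energy M x = (\<Sum>k\<in>?I. (cmod (x k))\<^sup>2)"
    unfolding energy_def using I by (intro sum.mono_neutral_right) (auto simp: support_def)
  also have "\<dots> = (\<Sum>k\<in>?S \<inter> ?I. (cmod (x k))\<^sup>2) + (\<Sum>k\<in>?I - ?S. (cmod (x k))\<^sup>2)"
    using finite_subset[OF I] by (subst sum.Int_Diff[of _ _ ?S]) (auto simp: Int_commute)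
  finally have "energy M x = (\<Sum>k\<in>?S \<inter> ?I. (cmod (x k))\<^sup>2) + (\<Sum>k\<in>?I - ?S. (cmod (x k))\<^sup>2)" .
  with fail have "\<gamma> * energy M x \<le> (\<Sum>k\<in>?I - ?S. (cmod (x k))\<^sup>2)"
    unfolding success3_def y_def[symmetric] by (simp add: algebra_simps)
  with out have "\<gamma> * energy M x / 2 \<le> (\<Sum>j\<in>{1..M}. (cmod (h j - x j))\<^sup>2)" by simp
  then have "\<gamma> * energy M x / 2 * (real N)\<^sup>2 \<le> (\<Sum>j\<in>{1..M}. (real N)\<^sup>2 * (cmod (h j - x j))\<^sup>2)"
    unfolding sum_distrib_left[symmetric] by (subst mult.commute) (rule mult_left_mono, simp_all)
  also have "\<dots> = (\<Sum>q\<in>{1..M} \<times> UNIV. (\<Sum>i\<in>{1..N}. residual M \<nu> x i q (A, n))\<^sup>2)"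
    unfolding sum_prod_bool by (intro sum.cong refl err)
  finally show ?thesis using \<omega> by (simp add: large_error_def)
qed

lemma p_err_nonneg: "0 \<le> p_err \<gamma> \<nu> M N D x"
  unfolding p_err_def p_err_given_def by (intro integral_nonneg_AE AE_I2) simp

text \<open>\<open>p_err\<close> is an iterated integral. \<open>large_error\<close> is measurable
  on the product space, so its sections majorise the failure events for fixed \<open>A\<close>, and
  Tonelli recombines them into one probability.\<close>

lemma p_err_le_prob_large_error:
  assumes \<nu>: "\<nu> > 0" and N: "N \<ge> 1" and card: "card (support M x) = L"
  shows "p_err \<gamma> \<nu> M N (top_decoder M N L) x \<le> measure (model N M \<nu>) (large_error N M \<nu> x (\<gamma> * energy M x / 2))"
proof -
  let ?E = "large_error N M \<nu> x (\<gamma> * energy M x / 2)"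
  let ?G = "gaussian_matrix N M" and ?H = "gaussian_noise N \<nu>"
  interpret G: prob_space ?G by (rule prob_space_gaussian_matrix)
  interpret H: prob_space ?H using \<nu> by (rule prob_space_gaussian_noise)
  interpret GH: pair_prob_space ?G ?H ..
  have "?E \<in> sets (model N M \<nu>)"
    unfolding large_error_def
    by (intro borel_measurable_le borel_measurable_const measurable_norm_residual \<nu> N)
  then have E: "?E \<in> sets (?G \<Otimes>\<^sub>M ?H)" by (simp add: model_def)
  have meas: "(\<lambda>A. measure ?H (Pair A -` ?E)) \<in> borel_measurable ?G"
    using H.measurable_emeasure_Pair[OF E] unfolding measure_def by measurable
  have int: "integrable ?G (\<lambda>A. measure ?H (Pair A -` ?E))"
    by (rule G.integrable_const_bound[where B=1]) (use meas in auto)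
  have "p_err \<gamma> \<nu> M N (top_decoder M N L) x \<le> (\<integral>A. measure ?H (Pair A -` ?E) \<partial>?G)"
    unfolding p_err_def
  proof (rule integral_mono_AE'[OF int])
    show "AE A in ?G. p_err_given \<gamma> \<nu> M N (top_decoder M N L) x A \<le> measure ?H (Pair A -` ?E)"
    proof (rule AE_I2)
      fix A assume A: "A \<in> space ?G"
      show "p_err_given \<gamma> \<nu> M N (top_decoder M N L) x A \<le> measure ?H (Pair A -` ?E)"
        unfolding p_err_given_def
      proof (rule H.finite_measure_mono)
        show "{n \<in> space ?H. \<not> success3 \<gamma> M x (top_decoder M N L (observation N M x A n) A)} \<subseteq> Pair A -` ?E"
          using A by (auto intro!: failure_subset_large_error[OF \<nu> N card] simp: model_def space_pair_measure)
        show "Pair A -` ?E \<in> sets ?H" using E by (rule sets_Pair1)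
      qed
    qed
  qed (simp add: p_err_given_def)
  also have "\<dots> = measure (?G \<Otimes>\<^sub>M ?H) ?E"
  proof -
    have "emeasure (?G \<Otimes>\<^sub>M ?H) ?E = (\<integral>\<^sup>+A. emeasure ?H (Pair A -` ?E) \<partial>?G)"
      by (rule H.emeasure_pair_measure_alt[OF E])
    also have "\<dots> = ennreal (\<integral>A. measure ?H (Pair A -` ?E) \<partial>?G)"
      unfolding H.emeasure_eq_measure by (rule nn_integral_eq_integral[OF int]) simp
    finally show ?thesis by (simp add: measure_def)
  qed
  finally show ?thesis by (simp add: model_def)
qed

theorem mainTheorem5:
  fixes \<gamma> \<beta> \<nu> P :: real
  assumes "0 < \<gamma>" "\<gamma> < 1" "\<beta> > 2" "\<nu> > 0"
  shows "\<exists>C5 > 1. \<forall>(x :: nat \<Rightarrow> nat \<Rightarrow> complex) (N :: nat \<Rightarrow> nat).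
           (\<forall>M \<in> admissible \<beta>. card (support M (x M)) = sparsity \<beta> M \<and> energy M (x M) = P) \<longrightarrow>
           (\<forall>M \<in> admissible \<beta>. N M \<ge> 1) \<longrightarrow>
           succ_on (admissible \<beta>) (\<lambda>M. real (N M)) (\<lambda>M. C5 * real (sparsity \<beta> M)) \<longrightarrow>
           asymptotic_reliable_recovery3 \<gamma> \<beta> \<nu> N x"
proof -
  define V where "V = \<nu>\<^sup>2 + P"
  define \<kappa> where "\<kappa> = 3 * (1 + V\<^sup>2) / 2"
  define K where "K = 420 * (1 + V ^ 4) + 8 * V\<^sup>2"
  define \<delta> where "\<delta> = \<gamma> * P / 2"
  \<comment> \<open>\<open>2 * \<beta>\<close> converts \<open>L\<close> into \<open>M\<close>, the
    summand 1 yields \<open>M \<le> N\<close>, and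
    \<open>4 * \<kappa> / \<bar>\<delta>\<bar>\<close> keeps the mean below half the threshold.
    \<open>C\<close> is chosen for any real \<open>P\<close>: the absolute value, together with
    division by 0 giving 0, ensures \<open>C > 1\<close> before \<open>P > 0\<close> is
    known.\<close>
  define C where "C = 2 * \<beta> * (1 + 4 * \<kappa> / \<bar>\<delta>\<bar>)"
  have \<kappa>: "\<kappa> \<ge> 0" and K: "K \<ge> 0" unfolding \<kappa>_def K_def by (auto intro!: add_nonneg_nonneg)
  have "2 * \<beta> * 1 \<le> C" unfolding C_def using \<kappa> assms by (intro mult_left_mono) auto
  then have C1: "C > 1" using assms by simp
  have admissible_iff: "M \<in> admissible \<beta> \<longleftrightarrow> \<beta> \<le> real M" for M
    using assms by (simp add: admissible_def sparsity_def le_nat_iff le_floor_iff field_simps)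
  \<comment> \<open>The floor loses less than 1, which is at most \<open>L\<close> because
    \<open>L \<ge> 1\<close>.\<close>
  have half: "real M \<le> 2 * \<beta> * real (sparsity \<beta> M)" if "M \<in> admissible \<beta>" for M
  proof -
    have "1 \<le> sparsity \<beta> M" using that by (simp add: admissible_def)
    moreover have "real M / \<beta> < real (sparsity \<beta> M) + 1"
      unfolding sparsity_def using assms by linarith
    ultimately have "real M / \<beta> \<le> 2 * real (sparsity \<beta> M)" by linarith
    then show ?thesis using assms by (simp add: field_simps)
  qed
  show ?thesis
  proof (intro exI[of _ C] conjI C1 allI impI)
    fix x :: "nat \<Rightarrow> nat \<Rightarrow> complex" and N :: "nat \<Rightarrow> nat"
    assume x: "\<forall>M \<in> admissible \<beta>. card (support M (x M)) = sparsity \<beta> M \<and> energy M (x M) = P"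
      and N1: "\<forall>M \<in> admissible \<beta>. N M \<ge> 1"
      and succ: "succ_on (admissible \<beta>) (\<lambda>M. real (N M)) (\<lambda>M. C * real (sparsity \<beta> M))"
    define M1 where "M1 = nat \<lceil>\<beta>\<rceil>"
    have adm: "M \<in> admissible \<beta>" if "M \<ge> M1" for M
      using that unfolding admissible_iff M1_def by linarith
    \<comment> \<open>Forced by the hypotheses: at the admissible dimension \<open>M1\<close> the
      support is non-empty.\<close>
    have P: "P > 0"
    proof -
      have "1 \<le> card (support M1 (x M1))" using x adm[of M1] by (auto simp: admissible_def)
      then have "support M1 (x M1) \<noteq> {}" by auto
      then obtain i where i: "i \<in> support M1 (x M1)" by blast
      then have "0 < (cmod (x M1 i))\<^sup>2" "i \<in> {1..M1}" by (auto simp: support_def)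
      then have "0 < energy M1 (x M1)" unfolding energy_def by (intro sum_pos2[of _ i]) auto
      then show ?thesis using x adm[of M1] by auto
    qed
    then have \<delta>: "\<delta> > 0" using assms by (simp add: \<delta>_def)
    have "N M1 \<ge> 1" using N1 adm[of M1] by simp
    \<comment> \<open>\<open>N \<ge> 1\<close> excludes the alternative of \<open>succ_on\<close> in
      which both functions vanish.\<close>
    then have "\<not> (\<forall>M\<in>admissible \<beta>. real (N M) = 0 \<and> C * real (sparsity \<beta> M) = 0)"
      using adm[OF order_refl] by (intro notI) (drule bspec, assumption, simp)
    then have "\<exists>M0. \<forall>M\<in>admissible \<beta>. M > M0 \<longrightarrow> real (N M) / (C * real (sparsity \<beta> M)) > 1"
      using succ unfolding succ_on_def by satx
    then obtain M0 where M0: "\<And>M. M \<in> admissible \<beta> \<Longrightarrow> M > M0 \<Longrightarrow> real (N M) / (C * real (sparsity \<beta> M)) > 1"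
      by blast
    have large: "real M + 4 * real M * \<kappa> / \<delta> \<le> real (N M)" if M: "M \<in> admissible \<beta>" "M > M0" for M
    proof -
      have "0 < C * real (sparsity \<beta> M)" using C1 M by (simp add: admissible_def)
      then have "C * real (sparsity \<beta> M) < real (N M)" using M0[OF M] by (simp add: field_simps)
      moreover have "(1 + 4 * \<kappa> / \<delta>) * real M \<le> (1 + 4 * \<kappa> / \<delta>) * (2 * \<beta> * real (sparsity \<beta> M))"
        using half[OF M(1)] \<kappa> \<delta> by (intro mult_left_mono) auto
      ultimately show ?thesis using \<delta> by (simp add: C_def algebra_simps)
    qed
    let ?D = "\<lambda>M. top_decoder M (N M) (sparsity \<beta> M)"
    let ?B = "4 * (16 * \<kappa>\<^sup>2 + 8 * K) / \<delta>\<^sup>2"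
    have bound: "p_err \<gamma> \<nu> M (N M) (?D M) (x M) \<le> ?B / real M" if M: "M \<in> admissible \<beta>" "M > M0" for M
    proof -
      have en: "energy M (x M) = P" and card: "card (support M (x M)) = sparsity \<beta> M" using x M by auto
      have N: "N M \<ge> 1" using N1 M by auto
      have "0 \<le> 4 * real M * \<kappa> / \<delta>" using \<kappa> \<delta> by auto
      then have MN: "real M \<le> real (N M)" and "4 * real M * \<kappa> / \<delta> \<le> real (N M)"
        using large[OF M] by linarith+
      then have ratio: "4 * real M * \<kappa> \<le> real (N M) * \<delta>" using \<delta> by (simp add: field_simps)
      have "p_err \<gamma> \<nu> M (N M) (?D M) (x M) \<le> measure (model (N M) M \<nu>) (large_error (N M) M \<nu> (x M) \<delta>)"
        using p_err_le_prob_large_error[OF \<open>\<nu> > 0\<close> N card, of \<gamma>] by (simp add: en \<delta>_def)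
      also have "\<dots> \<le> 4 * (16 * \<kappa>\<^sup>2 + 8 * K) / (\<delta>\<^sup>2 * real (N M))"
        using prob_large_error[OF \<open>\<nu> > 0\<close> N _ \<delta>, of M "x M"] MN ratio
        unfolding en V_def[symmetric] \<kappa>_def[symmetric] K_def[symmetric] by simp
      also have "\<dots> = ?B / real (N M)" by simp
      \<comment> \<open>\<open>M \<le> N\<close> trades the bound for a null sequence that no longer
        involves \<open>N\<close>.\<close>
      also have "\<dots> \<le> ?B / real M"
        using MN M K assms by (intro divide_left_mono) (auto simp: admissible_iff)
      finally show ?thesis .
    qed
    have "(\<lambda>M. p_err \<gamma> \<nu> M (N M) (?D M) (x M)) \<longlonglongrightarrow> 0"
    proof (rule tendsto_sandwich[of "\<lambda>_. 0" _ _ "\<lambda>M. ?B / real M"])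
      show "\<forall>\<^sub>F M in sequentially. p_err \<gamma> \<nu> M (N M) (?D M) (x M) \<le> ?B / real M"
        using eventually_ge_at_top[of "max M1 (Suc M0)"]
        by eventually_elim (intro bound adm, auto)
      show "(\<lambda>M. ?B / real M) \<longlonglongrightarrow> 0" by (rule lim_const_over_n)
    qed (auto simp: p_err_nonneg)
    moreover have "is_decoder M (N M) (sparsity \<beta> M) (?D M)" if "M \<in> admissible \<beta>" for M
    proof (rule is_decoder_top_decoder)
      have "card (support M (x M)) \<le> card {1..M}" by (rule card_mono) (auto simp: support_def)
      then show "sparsity \<beta> M \<le> M" using x that by simp
    qed
    ultimately show "asymptotic_reliable_recovery3 \<gamma> \<beta> \<nu> N x"
      unfolding asymptotic_reliable_recovery3_def by (intro exI[of _ ?D] conjI ballI)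
  qed
qed

end
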